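(* Let $p$ be a prime, $G$ the Vilenkin group associated with $p$ and $G^*$ its dual group. Let $\Psi=\{\psi_1,\dots,\psi_{p-1}\}\subset L^2(G)$ be an MRA Parseval frame multiwavelet, let $\phi\in L^2(G)$ be a pseudo-scaling function, and let $M=\{m_0,m_1,\dots,m_{p-1}\}\in\tilde F_\phi$, i.e. $M$ is a generalized filter with $$\hat\phi(B\omega)=m_0(\omega)\hat\phi(\omega)\quad\text{for a.e. }\omega\in G^*.$$ Suppose that $\Psi$, $\phi$ and $M$ are related by $$\hat\psi_i(B\omega)=W^*_\alpha(\omega)\,s_i(B\omega)\,\overline{m_i(\omega)}\,\hat\phi(\omega)\quad\text{for a.e. }\omega\in G^*,\qquad 1\le i\le p-1,$$ for some $\alpha\in\mathbb Z_+$ and some measurable unimodular functions $s_1,\dots,s_{p-1}$ on $G^*$. Then $M\in\tilde F_0$, that is, $M$ is a generalized low-pass filter.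
   Context: Vilenkin group: $G$ is the group of sequences $x=(x_j)_{j\in\mathbb Z}$ with $x_j\in\{0,1,\dots,p-1\}$ and $x_j=0$ for all $j<k(x)$ (some $k(x)\in\mathbb Z$ depending on $x$), with coordinatewise addition modulo $p$, denoted $\oplus$ (inverse operation $\ominus$). Its topology has the neighbourhood base of zero $U_l=\{x\in G: x_j=0\text{ for }j\le l\}$, $l\in\mathbb Z$; $U=U_0$, and the Haar measure is normalized so that $U$ has measure $1$. The dual group $G^*$ consists of sequences $\omega=(\omega_j)$ of the same form, with the same operation (also written $+$), topology and normalized Haar measure $|\cdot|$; the pairing is $\chi(x,\omega)=\exp\big(\frac{2\pi i}{p}\sum_{j\in\mathbb Z}x_j\omega_{1-j}\big)$. The Fourier transform is $\hat f(\omega)=\int_G f(x)\overline{\chi(x,\omega)}\,dx$, extended to $L^2(G)$. $H=\{x\in G:x_j=0\text{ for }j>0\}$ is a discrete subgroup of $G$, with annihilator $H^\perp=\{\omega\in G^*:\omega_j=0\text{ for }j>0\}$. The automorphism $A$ of $G$ is $(Ax)_j=x_{j+1}$, and the automorphism $B$ of $G^*$ is $(B\omega)_j=\omega_{j+1}$. For $\alpha\in\mathbb Z_+=\{0,1,2,\dots\}$, $h_{[\alpha]}\in H$ is the unique element with $\sum_j (h_{[\alpha]})_j p^{-j}=\alpha$, and $W^*_\alpha(\omega)=\chi(h_{[\alpha]},\omega)$ for $\omega\in G^*$. Generalized filter: a family $M=\{m_0,m_1,\dots,m_{p-1}\}$ of bounded measurable $H^\perp$-periodic complex functions on $G^*$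 such that for a.e. $\omega$ $$\sum_{i=0}^{p-1}|m_i(\omega)|^2=1,$$ $$m_0(\omega)\overline{m_0(\omega+\beta)}-\sum_{i=1}^{p-1}m_i(\omega)\overline{m_i(\omega+\beta)}=0\quad\text{for }\beta=B^{-1}\gamma,\ \gamma\in H^\perp\setminus BH^\perp.$$ $\tilde F$ denotes the set of generalized filters. A function $\phi\in L^2(G)$ is a pseudo-scaling function if there is $M=\{m_0,\dots,m_{p-1}\}\in\tilde F$ with $\hat\phi(B\omega)=m_0(\omega)\hat\phi(\omega)$ for a.e. $\omega$; $\tilde F_\phi$ is the set of all $M\in\tilde F$ satisfying this equation for $\phi$. For $M\in\tilde F$ (so $0\le|m_0|\le1$ a.e.) put $\hat\phi_{|m_0|}(\omega)=\prod_{j=1}^\infty|m_0(B^{-j}\omega)|$ (the limit of the nonincreasing partial products) and $N_0(|m_0|)=\{\omega\in G^*:\lim_{j\to\infty}\hat\phi_{|m_0|}(B^{-j}\omega)=0\}$. $M$ is a generalized low-pass filter if $|N_0(|m_0|)|=0$ (Haar measure zero); $\tilde F_0$ is the set of all generalized low-pass filters. Parseval frame multiwavelet (PFMW): a set $\Psi=\{\psi_1,\dots,\psi_{p-1}\}\subset L^2(G)$ such that the affine system $\{p^{j/2}\psi_l(A^jx\ominus h): j\in\mathbb Z,\ h\in H,\ 1\le l\le p-1\}$ is a Parseval frame for $L^2(G)$. A PFMW $\Psi$ is an MRA PFMW if there exist a pseudo-scaling function $\phi$, $M=\{m_0,\dots,m_{p-1}\}\in\tilde F_\phi$ and measurable unimodular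 functions $s_i$ on $G^*$ ($1\le i\le p-1$), and some $\alpha\in\mathbb Z_+$, such that $\hat\psi_i(B\omega)=W^*_\alpha(\omega)s_i(B\omega)\overline{m_i(\omega)}\hat\phi(\omega)$ for a.e. $\omega$ and $1\le i\le p-1$. *)

theory Defs
  imports "HOL-Analysis.Analysis" "HOL-Computational_Algebra.Primes"
begin

section \<open>The Vilenkin group\<close>

text \<open>
  As a topological group with normalized Haar measure the dual group $G^*$ is the same object as
  $G$, so the constants of this section serve for both. The automorphisms $A$ and $B$ also act by
  the same formula and are both \<open>dil 1\<close>.
\<close>

type_synonym vseq = "int \<Rightarrow> nat"

definition vil :: "nat \<Rightarrow> vseq set" where
  "vil p = {x. (\<forall>j. x j < p) \<and> (\<exists>k. \<forall>j<k. x j = 0)}"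

definition vadd :: "nat \<Rightarrow> vseq \<Rightarrow> vseq \<Rightarrow> vseq" where
  "vadd p x y = (\<lambda>j. (x j + y j) mod p)"

definition vsub :: "nat \<Rightarrow> vseq \<Rightarrow> vseq \<Rightarrow> vseq" where
  "vsub p x y = (\<lambda>j. (x j + (p - y j)) mod p)"

definition vnbh :: "nat \<Rightarrow> int \<Rightarrow> vseq set" where
  "vnbh p l = {x \<in> vil p. \<forall>j\<le>l. x j = 0}"

definition vopen :: "nat \<Rightarrow> vseq set \<Rightarrow> bool" where
  "vopen p V \<longleftrightarrow> V \<subseteq> vil p \<and> (\<forall>x\<in>V. \<exists>l. vadd p x ` vnbh p l \<subseteq> V)"

lemma istopology_vopen: "istopology (vopen p)"
proof -
  have mono: "vnbh p (max k l) \<subseteq> vnbh p k \<inter> vnbh p l" for k l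
    by (auto simp: vnbh_def)
  show ?thesis
    unfolding istopology_def
  proof (intro conjI allI impI)
    fix S T assume S: "vopen p S" and T: "vopen p T"
    have "\<exists>l. vadd p x ` vnbh p l \<subseteq> S \<inter> T" if x: "x \<in> S \<inter> T" for x
    proof -
      obtain k where k: "vadd p x ` vnbh p k \<subseteq> S"
        using S x by (meson IntD1 vopen_def)
      obtain l where l: "vadd p x ` vnbh p l \<subseteq> T"
        using T x by (meson IntD2 vopen_def)
      have "vadd p x ` vnbh p (max k l) \<subseteq> vadd p x ` vnbh p k \<inter> vadd p x ` vnbh p l"
        using mono[of k l] by (meson Int_greatest image_mono le_inf_iff)
      then have "vadd p x ` vnbh p (max k l) \<subseteq> S \<inter> T"
        using k l by (meson Int_mono order_trans)
      then show ?thesis ..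
    qed
    then show "vopen p (S \<inter> T)"
      using S unfolding vopen_def by (meson inf.coboundedI1)
  next
    fix K assume K: "\<forall>S\<in>K. vopen p S"
    show "vopen p (\<Union>K)"
      unfolding vopen_def
    proof (intro conjI ballI)
      show "\<Union>K \<subseteq> vil p"
        using K by (meson Sup_least vopen_def)
      fix x assume "x \<in> \<Union>K"
      then obtain S where "S \<in> K" "x \<in> S" ..
      with K obtain l where "vadd p x ` vnbh p l \<subseteq> S"
        by (meson vopen_def)
      with \<open>S \<in> K\<close> show "\<exists>l. vadd p x ` vnbh p l \<subseteq> \<Union>K"
        by (meson Sup_upper order_trans)
    qed
  qed
qed

definition vtop :: "nat \<Rightarrow> vseq topology" where
  "vtop p = topology (vopen p)"

text \<open>
  The normalized Haar measure on the Borel sets. Finiteness on compact sets and regularity need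
  not be required: a compact set is covered by finitely many cosets of $U = U_0$, and $G$ is
  locally compact and second countable.
\<close>

definition haar_measure :: "nat \<Rightarrow> vseq measure \<Rightarrow> bool" where
  "haar_measure p \<mu> \<longleftrightarrow>
     space \<mu> = vil p \<and>
     sets \<mu> = sigma_sets (vil p) {V. openin (vtop p) V} \<and>
     (\<forall>x\<in>vil p. \<forall>E\<in>sets \<mu>. emeasure \<mu> (vadd p x ` E) = emeasure \<mu> E) \<and>
     emeasure \<mu> (vnbh p 0) = 1"

text \<open>The \<open>k\<close>-th power, \<open>k\<close> any integer, of the automorphism $(Ax)_j = x_{j+1}$.\<close>

definition dil :: "int \<Rightarrow> vseq \<Rightarrow> vseq" where
  "dil k x = (\<lambda>j. x (j + k))"

lemma dil_0 [simp]: "dil 0 x = x"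
  and dil_dil: "dil k (dil l x) = dil (k + l) x"
  and funpow_dil_1: "(dil 1 ^^ n) x = dil (int n) x"
proof -
  show "dil 0 x = x"
    by (simp add: dil_def)
  have *: "dil k (dil l x) = dil (k + l) x" for k l x
    by (simp add: dil_def algebra_simps)
  then show "dil k (dil l x) = dil (k + l) x" .
  show "(dil 1 ^^ n) x = dil (int n) x"
    by (induction n) (simp_all only: funpow.simps o_apply id_apply * of_nat_0 of_nat_Suc, simp add: dil_def)
qed

text \<open>This set is both $H \subseteq G$ and, in $G^*$, the annihilator $H^\perp$.\<close>

definition vH :: "nat \<Rightarrow> vseq set" where
  "vH p = {x \<in> vil p. \<forall>j>0. x j = 0}"

text \<open>For \<open>x\<close> and \<open>\<omega>\<close> in \<open>vil p\<close> only finitely many summands are nonzero.\<close>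

definition chi :: "nat \<Rightarrow> vseq \<Rightarrow> vseq \<Rightarrow> complex" where
  "chi p x \<omega> = exp (2 * of_real pi * \<i> / of_nat p *
     of_nat (\<Sum>j | x j * \<omega> (1 - j) \<noteq> 0. x j * \<omega> (1 - j)))"

definition hidx :: "nat \<Rightarrow> nat \<Rightarrow> vseq" where
  "hidx p \<alpha> = (THE h. h \<in> vH p \<and>
     (\<Sum>j | h j \<noteq> 0. real (h j) * real p powi (- j)) = real \<alpha>)"

definition Wstar :: "nat \<Rightarrow> nat \<Rightarrow> vseq \<Rightarrow> complex" where
  "Wstar p \<alpha> \<omega> = chi p (hidx p \<alpha>) \<omega>"

section \<open>Square integrable functions and the Fourier transform\<close>

definition L2 :: "'a measure \<Rightarrow> ('a \<Rightarrow> complex) set" where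
  "L2 \<mu> = {f \<in> borel_measurable \<mu>. integrable \<mu> (\<lambda>x. (cmod (f x))\<^sup>2)}"

definition L2_tendsto :: "'a measure \<Rightarrow> (nat \<Rightarrow> 'a \<Rightarrow> complex) \<Rightarrow> ('a \<Rightarrow> complex) \<Rightarrow> bool" where
  "L2_tendsto \<mu> g f \<longleftrightarrow>
     (\<lambda>n. \<integral>\<^sup>+x. ennreal ((cmod (g n x - f x))\<^sup>2) \<partial>\<mu>) \<longlonglongrightarrow> 0"

definition fourier_L1 :: "nat \<Rightarrow> vseq measure \<Rightarrow> (vseq \<Rightarrow> complex) \<Rightarrow> vseq \<Rightarrow> complex" where
  "fourier_L1 p \<mu> f \<omega> = (\<integral>x. f x * cnj (chi p x \<omega>) \<partial>\<mu>)"

text \<open>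
  The continuous extension from $L^1 \cap L^2$ to $L^2$, whose graph is the closure of the graph
  of the integral transform. The choice only selects a representative: by Plancherel's theorem
  the limit exists and is unique up to null sets.
\<close>

definition fourier :: "nat \<Rightarrow> vseq measure \<Rightarrow> (vseq \<Rightarrow> complex) \<Rightarrow> vseq \<Rightarrow> complex" where
  "fourier p \<mu> f = (SOME F. F \<in> L2 \<mu> \<and>
     (\<exists>g. (\<forall>n. g n \<in> L2 \<mu> \<and> integrable \<mu> (g n)) \<and>
          L2_tendsto \<mu> g f \<and> L2_tendsto \<mu> (\<lambda>n. fourier_L1 p \<mu> (g n)) F))"

section \<open>Generalized filters\<close>

definition periodic :: "nat \<Rightarrow> (vseq \<Rightarrow> complex) \<Rightarrow> bool" where
  "periodic p f \<longleftrightarrow> (\<forall>\<omega>\<in>vil p. \<forall>\<gamma>\<in>vH p. f (vadd p \<omega> \<gamma>) = f \<omega>)"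

text \<open>A family $\{m_0,\dots,m_{p-1}\}$ is a function of the index, of which only the values at
  indices below \<open>p\<close> matter.\<close>

definition gen_filters :: "nat \<Rightarrow> vseq measure \<Rightarrow> (nat \<Rightarrow> vseq \<Rightarrow> complex) set" where
  "gen_filters p \<mu> = {m.
     (\<forall>i<p. m i \<in> borel_measurable \<mu> \<and> (\<exists>C. \<forall>\<omega>\<in>vil p. cmod (m i \<omega>) \<le> C) \<and> periodic p (m i)) \<and>
     (AE \<omega> in \<mu>.
        (\<Sum>i<p. (cmod (m i \<omega>))\<^sup>2) = 1 \<and>
        (\<forall>\<gamma> \<in> vH p - dil 1 ` vH p.
           let \<beta> = dil (-1) \<gamma> in
             m 0 \<omega> * cnj (m 0 (vadd p \<omega> \<beta>))
             - (\<Sum>i=1..p-1. m i \<omega> * cnj (m i (vadd p \<omega> \<beta>))) = 0))}"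

definition gen_filters_of ::
    "nat \<Rightarrow> vseq measure \<Rightarrow> (vseq \<Rightarrow> complex) \<Rightarrow> (nat \<Rightarrow> vseq \<Rightarrow> complex) set" where
  "gen_filters_of p \<mu> \<phi> = {m \<in> gen_filters p \<mu>.
     AE \<omega> in \<mu>. fourier p \<mu> \<phi> (dil 1 \<omega>) = m 0 \<omega> * fourier p \<mu> \<phi> \<omega>}"

definition pseudo_scaling :: "nat \<Rightarrow> vseq measure \<Rightarrow> (vseq \<Rightarrow> complex) \<Rightarrow> bool" where
  "pseudo_scaling p \<mu> \<phi> \<longleftrightarrow> \<phi> \<in> L2 \<mu> \<and> (\<exists>m. m \<in> gen_filters_of p \<mu> \<phi>)"

definition phi_hat_abs :: "(vseq \<Rightarrow> complex) \<Rightarrow> vseq \<Rightarrow> real" where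
  "phi_hat_abs m0 \<omega> = lim (\<lambda>n. \<Prod>j=1..n. cmod (m0 (dil (- int j) \<omega>)))"

definition N0 :: "nat \<Rightarrow> (vseq \<Rightarrow> complex) \<Rightarrow> vseq set" where
  "N0 p m0 = {\<omega> \<in> vil p. (\<lambda>j. phi_hat_abs m0 (dil (- int j) \<omega>)) \<longlonglongrightarrow> 0}"

definition gen_low_pass_filters :: "nat \<Rightarrow> vseq measure \<Rightarrow> (nat \<Rightarrow> vseq \<Rightarrow> complex) set" where
  "gen_low_pass_filters p \<mu> = {m \<in> gen_filters p \<mu>. N0 p (m 0) \<in> null_sets \<mu>}"

section \<open>Parseval frame multiwavelets\<close>

definition parseval_frame :: "'a measure \<Rightarrow> 'i set \<Rightarrow> ('i \<Rightarrow> 'a \<Rightarrow> complex) \<Rightarrow> bool" where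
  "parseval_frame \<mu> I g \<longleftrightarrow>
     (\<forall>i\<in>I. g i \<in> L2 \<mu>) \<and>
     (\<forall>f\<in>L2 \<mu>. ((\<lambda>i. (cmod (\<integral>x. f x * cnj (g i x) \<partial>\<mu>))\<^sup>2)
                   has_sum (\<integral>x. (cmod (f x))\<^sup>2 \<partial>\<mu>)) I)"

definition affine_system ::
    "nat \<Rightarrow> (nat \<Rightarrow> vseq \<Rightarrow> complex) \<Rightarrow> int \<times> vseq \<times> nat \<Rightarrow> vseq \<Rightarrow> complex" where
  "affine_system p \<psi> = (\<lambda>(j, h, l) x.
     of_real (real p powr (of_int j / 2)) * \<psi> l (vsub p (dil j x) h))"

definition pfmw :: "nat \<Rightarrow> vseq measure \<Rightarrow> (nat \<Rightarrow> vseq \<Rightarrow> complex) \<Rightarrow> bool" where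
  "pfmw p \<mu> \<psi> \<longleftrightarrow>
     (\<forall>l\<in>{1..p-1}. \<psi> l \<in> L2 \<mu>) \<and>
     parseval_frame \<mu> (UNIV \<times> vH p \<times> {1..p-1}) (affine_system p \<psi>)"

definition unimodular :: "nat \<Rightarrow> vseq measure \<Rightarrow> (vseq \<Rightarrow> complex) \<Rightarrow> bool" where
  "unimodular p \<mu> s \<longleftrightarrow> s \<in> borel_measurable \<mu> \<and> (\<forall>\<omega>\<in>vil p. cmod (s \<omega>) = 1)"

definition mra_pfmw :: "nat \<Rightarrow> vseq measure \<Rightarrow> (nat \<Rightarrow> vseq \<Rightarrow> complex) \<Rightarrow> bool" where
  "mra_pfmw p \<mu> \<psi> \<longleftrightarrow> pfmw p \<mu> \<psi> \<and>
     (\<exists>\<phi> m s \<alpha>. pseudo_scaling p \<mu> \<phi> \<and> m \<in> gen_filters_of p \<mu> \<phi> \<and>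
        (\<forall>i\<in>{1..p-1}. unimodular p \<mu> (s i)) \<and>
        (\<forall>i\<in>{1..p-1}. AE \<omega> in \<mu>.
           fourier p \<mu> (\<psi> i) (dil 1 \<omega>) =
             Wstar p \<alpha> \<omega> * s i (dil 1 \<omega>) * cnj (m i \<omega>) * fourier p \<mu> \<phi> \<omega>))"

end

theory Submission
  imports Defs
begin

text \<open>
  Write $L(\omega) = \lim_n |\hat\phi(B^{-n}\omega)|$, a monotone limit because $|m_0| \le 1$. Since
  $|\hat\phi(B\omega)| = |m_0(\omega)|\,|\hat\phi(\omega)|$, one has
  $|\hat\phi| = \hat\phi_{|m_0|} L$; if $L(\omega) < \infty$ and $\omega$ lies in $N_0(|m_0|)$, then
  $\hat\phi$, and with it every $\hat\psi_i$, vanishes along the whole orbit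
  $\{B^k\omega\}$. The identity $\sum_i |m_i|^2 = 1$ telescopes
  $\sum_{j \ge 0} \sum_i |\hat\psi_i(B^{-j}\omega)|^2$ to $L(\omega)^2 - |\hat\phi(\omega)|^2$, so two
  facts about the frame suffice, and the full Calderon identity is not needed:
  the $\hat\psi_i$ cannot all vanish on a set of positive measure that is invariant under $B$
  (a function with transform supported there would be orthogonal to the frame), and the sum over
  $j \ge 0$ is finite almost everywhere. For the latter, test the frame on functions whose transform
  is the indicator of a coset of $U$: their coefficients, as functions on $G$, have constant modulus on the
  cosets of $U$, so that the sum over $H$ is an integral over $G$, to which Plancherel's theorem
  applies.
\<close>

section \<open>Cosets and the Haar measure\<close>

text \<open>Test functions are built on the dual side, as \<open>ift T\<close> with \<open>T\<close>
  both integrable and square integrable. Fubini then turns the coefficient of \<open>ift T\<close>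
  against an affine function into an integral of \<open>T\<close> against the conjugate transform of
  \<open>\<psi> l\<close>, and what remains is to compare \<open>sqn \<mu> T\<close> with
  \<open>sqn \<mu> (ift T)\<close>: an upper bound for every integrable \<open>T\<close>, and a
  lower bound, up to a factor 4, for conjugate transforms restricted to a coset. Losing a constant
  is harmless because the sum over scales only has to be finite; this lets all norm estimates run
  through |a + b|^2 <= 2 |a|^2 + 2 |b|^2. The sign of the scale matters. For j >= 0 the map
  \<open>dil (- j)\<close> shrinks a coset of U into a single coset of U, and only on functions
  supported in one such coset does sampling over H recover the integral. These are also the scales
  that occur in the telescoping sum. Statements obtained on one coset are glued together over a
  countable set of centres.\<close>

lemma openin_vtop: "openin (vtop p) = vopen p"
  unfolding vtop_def by (rule topology_inverse'[OF istopology_vopen])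

text \<open>For \<open>e\<close> in the group this is its coset modulo \<open>vnbh p n\<close>. The
  coordinate form ignores \<open>e\<close> beyond \<open>n\<close>, so \<open>e\<close> can be
  truncated without changing the set.\<close>

definition cyl :: "nat \<Rightarrow> vseq \<Rightarrow> int \<Rightarrow> vseq set" where
  "cyl p e n = {x \<in> vil p. \<forall>j\<le>n. x j = e j}"

lemma vnbh_eq_cyl: "vnbh p n = cyl p (\<lambda>_. 0) n"
  by (simp add: vnbh_def cyl_def)

text \<open>A countable set that meets every coset of every \<open>vnbh p n\<close>. Statements
  proved almost everywhere on one coset are combined over these centres.\<close>

definition vfin :: "nat \<Rightarrow> vseq set" where
  "vfin p = {x \<in> vil p. \<exists>n. \<forall>j>n. x j = 0}"

lemma vfin_subset: "vfin p \<subseteq> vil p"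
  by (auto simp: vfin_def)

lemma finite_vil_support: "finite {x \<in> vil p. \<forall>j. j \<notin> {a..b} \<longrightarrow> x j = 0}"
proof -
  have "finite {f. \<forall>j. (j \<in> {a..b} \<longrightarrow> f j \<in> {..<p}) \<and> (j \<notin> {a..b} \<longrightarrow> f j = (0::nat))}"
    by (rule finite_set_of_finite_funs) auto
  then show ?thesis
    by (rule finite_subset[rotated]) (auto simp: vil_def)
qed

lemma countable_vfin: "countable (vfin p)"
proof -
  have "vfin p \<subseteq> (\<Union>a. \<Union>b. {x \<in> vil p. \<forall>j. j \<notin> {a..b} \<longrightarrow> x j = 0})"
  proof
    fix x assume "x \<in> vfin p"
    then obtain a b where x: "x \<in> vil p" "\<forall>j<a. x j = 0" "\<forall>j>b. x j = 0"
      by (auto simp: vfin_def vil_def)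
    then have "\<forall>j. j \<notin> {a..b} \<longrightarrow> x j = 0"
      by auto
    with x(1) show "x \<in> (\<Union>a. \<Union>b. {x \<in> vil p. \<forall>j. j \<notin> {a..b} \<longrightarrow> x j = 0})"
      by blast
  qed
  moreover have "countable (\<Union>a. \<Union>b. {x \<in> vil p. \<forall>j. j \<notin> {a::int..b} \<longrightarrow> x j = 0})"
    by (intro countable_UN countableI_type countable_finite[OF finite_vil_support])
  ultimately show ?thesis
    by (rule countable_subset)
qed

lemma cyl_subset: "cyl p e n \<subseteq> vil p"
  by (auto simp: cyl_def)

lemma cyl_trunc:
  assumes "e \<in> vil p"
  obtains e' where "e' \<in> vfin p" "cyl p e n = cyl p e' n"
proof
  let ?e = "\<lambda>j. if j \<le> n then e j else 0"
  have "?e \<in> vil p"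
    using assms by (auto simp: vil_def)
  then show "?e \<in> vfin p"
    by (auto simp: vfin_def intro: exI[of _ n])
  show "cyl p e n = cyl p ?e n"
    by (simp add: cyl_def)
qed

definition cyls :: "nat \<Rightarrow> vseq set set" where
  "cyls p = {cyl p e n | e n. e \<in> vfin p}"

lemma cylsE:
  assumes "C \<in> cyls p"
  obtains e n where "e \<in> vfin p" "C = cyl p e n"
  using assms unfolding cyls_def by blast

lemma cyl_in_cyls: "e \<in> vil p \<Longrightarrow> cyl p e n \<in> cyls p"
  unfolding cyls_def by (rule cyl_trunc[of e p n]) blast+

lemma countable_cyls: "countable (cyls p)"
proof -
  have "cyls p = (\<lambda>(e, n). cyl p e n) ` (vfin p \<times> UNIV)"
    by (auto simp: cyls_def)
  then show ?thesis
    by (simp add: countable_vfin)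
qed

text \<open>Ultrametric geometry: of two cosets, either the finer lies inside the coarser or they
  are disjoint. With the empty set added they form a pi-system, as uniqueness of measures
  requires.\<close>

lemma Int_stable_cyls: "Int_stable (insert {} (cyls p))"
proof -
  have *: "cyl p a m \<inter> cyl p b n \<in> insert {} (cyls p)" if "a \<in> vfin p" "b \<in> vfin p" "m \<le> n" for a b m n
  proof (cases "\<forall>j\<le>m. a j = b j")
    case True
    then have "cyl p a m \<inter> cyl p b n = cyl p b n"
      using that by (auto simp: cyl_def)
    then show ?thesis
      using that vfin_subset[of p] cyl_in_cyls by auto
  next
    case False
    then obtain j where j: "j \<le> m" "a j \<noteq> b j" by blast
    have "x \<notin> cyl p b n" if "x \<in> cyl p a m" for x
    proof
      assume "x \<in> cyl p b n"
      then have "x j = b j" using j(1) \<open>m \<le> n\<close> by (simp add: cyl_def)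
      moreover have "x j = a j" using that j(1) by (simp add: cyl_def)
      ultimately show False using j(2) by simp
    qed
    then have "cyl p a m \<inter> cyl p b n = {}" by blast
    then show ?thesis by simp
  qed
  show ?thesis
    unfolding Int_stable_def
  proof (intro ballI)
    fix A B assume AB: "A \<in> insert {} (cyls p)" "B \<in> insert {} (cyls p)"
    show "A \<inter> B \<in> insert {} (cyls p)"
    proof (cases "A = {} \<or> B = {}")
      case False
      with AB have "A \<in> cyls p" "B \<in> cyls p" by auto
      then obtain a m b n where ab: "a \<in> vfin p" "A = cyl p a m" "b \<in> vfin p" "B = cyl p b n"
        by (elim cylsE)
      show ?thesis
      proof (cases "m \<le> n")
        case True
        from *[OF ab(1) ab(3) this] show ?thesis by (simp only: ab)
      next
        case False
        then have "n \<le> m" by simp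
        from *[OF ab(3) ab(1) this] show ?thesis by (simp only: ab Int_commute[of "cyl p a m"])
      qed
    qed auto
  qed
qed

text \<open>Pairing with \<open>vunit (1 - k)\<close> isolates coordinate \<open>k\<close>, so these
  elements tell characters apart in the orthogonality relation.\<close>

definition vunit :: "int \<Rightarrow> vseq" where
  "vunit k = (\<lambda>j. if j = k then 1 else 0)"

section \<open>The group operations and the Borel structure\<close>

locale vilenkin =
  fixes p :: nat and \<mu> :: "vseq measure"
  assumes prime_p: "prime p" and haar: "haar_measure p \<mu>"
begin

lemma p_gt_1: "1 < p"
  using prime_p by (rule prime_gt_1_nat)

lemma p_pos [simp]: "0 < p"
  using p_gt_1 by simp

lemma space_mu [simp]: "space \<mu> = vil p"
  using haar by (simp add: haar_measure_def)

lemma zero_vil [simp]: "(\<lambda>_. 0) \<in> vil p"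
  by (simp add: vil_def)

lemma vunit_vil [simp]: "vunit k \<in> vil p"
  using p_gt_1 by (auto simp: vil_def vunit_def intro: exI[of _ k])

lemma vadd_vil [simp]: "x \<in> vil p \<Longrightarrow> y \<in> vil p \<Longrightarrow> vadd p x y \<in> vil p"
proof -
  assume "x \<in> vil p" "y \<in> vil p"
  then obtain k l where "\<forall>j<k. x j = 0" "\<forall>j<l. y j = 0"
    by (auto simp: vil_def)
  then have "\<forall>j<min k l. vadd p x y j = 0"
    by (simp add: vadd_def)
  moreover have "\<forall>j. vadd p x y j < p"
    by (simp add: vadd_def)
  ultimately show ?thesis
    unfolding vil_def by blast
qed

lemma vsub_vil [simp]: "x \<in> vil p \<Longrightarrow> y \<in> vil p \<Longrightarrow> vsub p x y \<in> vil p"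
proof -
  assume "x \<in> vil p" "y \<in> vil p"
  then obtain k l where "\<forall>j<k. x j = 0" "\<forall>j<l. y j = 0"
    by (auto simp: vil_def)
  then have "\<forall>j<min k l. vsub p x y j = 0"
    by (simp add: vsub_def)
  moreover have "\<forall>j. vsub p x y j < p"
    by (simp add: vsub_def)
  ultimately show ?thesis
    unfolding vil_def by blast
qed

lemma dil_vil [simp]: "dil k x \<in> vil p \<longleftrightarrow> x \<in> vil p"
proof -
  have *: "dil k x \<in> vil p" if "x \<in> vil p" for k x
  proof -
    from that obtain l where "\<forall>j<l. x j = 0"
      by (auto simp: vil_def)
    then have "\<forall>j<l - k. dil k x j = 0"
      by (simp add: dil_def)
    with that show ?thesis
      by (auto simp: vil_def dil_def)
  qed
  from *[of x k] *[of "dil k x" "- k"] show ?thesis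
    by (auto simp: dil_dil)
qed

lemma vsub_vadd: "x \<in> vil p \<Longrightarrow> y \<in> vil p \<Longrightarrow> vsub p (vadd p y x) x = y"
proof
  fix j assume *: "x \<in> vil p" "y \<in> vil p"
  then have "x j < p" "y j < p" by (auto simp: vil_def)
  moreover have "((y j + x j) mod p + (p - x j)) mod p = (y j + x j + (p - x j)) mod p"
    by (rule mod_add_left_eq)
  ultimately show "vsub p (vadd p y x) x j = y j"
    by (simp add: vsub_def vadd_def)
qed

lemma vadd_vsub: "x \<in> vil p \<Longrightarrow> y \<in> vil p \<Longrightarrow> vadd p x (vsub p y x) = y"
proof
  fix j assume *: "x \<in> vil p" "y \<in> vil p"
  then have "x j < p" "y j < p" by (auto simp: vil_def)
  moreover have "(x j + (y j + (p - x j)) mod p) mod p = (x j + (y j + (p - x j))) mod p"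
    by (rule mod_add_right_eq)
  ultimately show "vadd p x (vsub p y x) j = y j"
    by (simp add: vsub_def vadd_def)
qed

lemma vadd_commute: "vadd p x y = vadd p y x"
  by (simp add: vadd_def add.commute)

lemma translate_vnbh: "x \<in> vil p \<Longrightarrow> vadd p x ` vnbh p n = cyl p x n"
proof (intro equalityI subsetI)
  fix y assume x: "x \<in> vil p" and "y \<in> vadd p x ` vnbh p n"
  then obtain u where u: "u \<in> vil p" "\<forall>j\<le>n. u j = 0" "y = vadd p x u"
    by (auto simp: vnbh_def)
  moreover have "x j < p" for j
    using x by (simp add: vil_def)
  ultimately show "y \<in> cyl p x n"
    using x by (simp add: cyl_def) (simp add: vadd_def)
next
  fix y assume x: "x \<in> vil p" and y: "y \<in> cyl p x n"
  then have "vsub p y x j = 0" if "j \<le> n" for j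
  proof -
    have "x j < p" "y j = x j" using x y that by (auto simp: vil_def cyl_def)
    then show ?thesis by (simp add: vsub_def)
  qed
  then have "vsub p y x \<in> vnbh p n"
    using x y cyl_subset[of p x n] by (auto simp: vnbh_def)
  moreover have "y = vadd p x (vsub p y x)"
    using x y cyl_subset[of p x n] by (auto simp: vadd_vsub)
  ultimately show "y \<in> vadd p x ` vnbh p n" by blast
qed

lemma vopen_cyl: "vopen p (cyl p e n)"
  unfolding vopen_def
proof (intro conjI ballI)
  show "cyl p e n \<subseteq> vil p" by (rule cyl_subset)
  fix x assume "x \<in> cyl p e n"
  then have "vadd p x ` vnbh p n \<subseteq> cyl p e n"
    by (subst translate_vnbh) (auto simp: cyl_def)
  then show "\<exists>l. vadd p x ` vnbh p l \<subseteq> cyl p e n" ..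
qed

lemma sets_mu_open: "sets \<mu> = sigma_sets (vil p) {V. vopen p V}"
  using haar by (simp add: haar_measure_def openin_vtop)

lemma sets_cyl [measurable, simp]: "cyl p e n \<in> sets \<mu>"
  unfolding sets_mu_open by (rule sigma_sets.Basic) (simp add: vopen_cyl)

text \<open>Cosets form a base of the topology and there are only countably many of them, so every
  open set is a countable union of cosets.\<close>

lemma sets_mu: "sets \<mu> = sigma_sets (vil p) (insert {} (cyls p))"
proof
  have C: "insert {} (cyls p) \<subseteq> Pow (vil p)"
    using cyl_subset by (auto simp: cyls_def)
  interpret S: sigma_algebra "vil p" "sigma_sets (vil p) (insert {} (cyls p))"
    by (rule sigma_algebra_sigma_sets[OF C])
  have "V \<in> sigma_sets (vil p) (insert {} (cyls p))" if V: "vopen p V" for V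
  proof -
    have "V = \<Union>{C \<in> cyls p. C \<subseteq> V}"
    proof (intro equalityI subsetI)
      fix x assume x: "x \<in> V"
      with V obtain n where xv: "x \<in> vil p" and "vadd p x ` vnbh p n \<subseteq> V"
        unfolding vopen_def by blast
      then have "cyl p x n \<subseteq> V"
        by (simp add: translate_vnbh)
      moreover have "x \<in> cyl p x n"
        using xv by (simp add: cyl_def)
      ultimately show "x \<in> \<Union>{C \<in> cyls p. C \<subseteq> V}"
        using cyl_in_cyls[OF xv] by blast
    qed auto
    also have "\<dots> \<in> sigma_sets (vil p) (insert {} (cyls p))"
      by (rule S.countable_Union) (auto intro: countable_subset[OF _ countable_cyls])
    finally show ?thesis .
  qed
  then show "sets \<mu> \<subseteq> sigma_sets (vil p) (insert {} (cyls p))"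
    unfolding sets_mu_open by (intro S.sigma_sets_subset) auto
  show "sigma_sets (vil p) (insert {} (cyls p)) \<subseteq> sets \<mu>"
    by (rule sets.sigma_sets_subset[of _ \<mu>, unfolded space_mu]) (auto simp: cyls_def)
qed

lemma sets_vnbh [measurable, simp]: "vnbh p n \<in> sets \<mu>"
  by (simp add: vnbh_eq_cyl)

lemma measurable_coord [measurable]: "(\<lambda>x. x j) \<in> measurable \<mu> (count_space UNIV)"
proof -
  have "(\<lambda>x. x j) -` {a} \<inter> space \<mu> \<in> sets \<mu>" for a
  proof -
    have "(\<lambda>x. x j) -` {a} \<inter> space \<mu> = \<Union>{C \<in> cyls p. C \<subseteq> {x. x j = a}}"
    proof (intro equalityI subsetI)
      fix x assume "x \<in> (\<lambda>x. x j) -` {a} \<inter> space \<mu>"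
      then have x: "x \<in> vil p" "x j = a" by auto
      then have "x \<in> cyl p x j" "cyl p x j \<subseteq> {x. x j = a}"
        by (auto simp: cyl_def)
      then show "x \<in> \<Union>{C \<in> cyls p. C \<subseteq> {x. x j = a}}"
        using cyl_in_cyls[OF x(1)] by blast
    next
      fix x assume "x \<in> \<Union>{C \<in> cyls p. C \<subseteq> {x. x j = a}}"
      then show "x \<in> (\<lambda>x. x j) -` {a} \<inter> space \<mu>"
        using cyl_subset unfolding cyls_def by fastforce
    qed
    also have "\<dots> \<in> sets \<mu>"
    proof (rule sets.countable_Union)
      show "countable {C \<in> cyls p. C \<subseteq> {x. x j = a}}"
        by (rule countable_subset[OF _ countable_cyls]) blast
    qed (auto simp: cyls_def)
    finally show ?thesis .
  qed
  then show ?thesis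
    by (subst measurable_count_space_eq2_countable) auto
qed

text \<open>A coset is cut out by countably many coordinate conditions, so measurability into the
  group can be tested one coordinate at a time.\<close>

lemma measurable_vil:
  assumes "\<And>x. x \<in> space N \<Longrightarrow> f x \<in> vil p"
    and [measurable]: "\<And>j. (\<lambda>x. f x j) \<in> measurable N (count_space UNIV)"
  shows "f \<in> measurable N \<mu>"
proof (rule measurable_sigma_sets[OF sets_mu])
  show "insert {} (cyls p) \<subseteq> Pow (vil p)"
    using cyl_subset by (auto simp: cyls_def)
  show "f \<in> space N \<rightarrow> vil p" using assms(1) by auto
  fix C assume "C \<in> insert {} (cyls p)"
  then consider "C = {}" | e n where "C = cyl p e n" by (auto simp: cyls_def)
  then show "f -` C \<inter> space N \<in> sets N"
  proof cases
    case 2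
    then have "f -` C \<inter> space N = {x \<in> space N. \<forall>j\<in>{..n}. f x j = e j}"
      using assms(1) by (auto simp: cyl_def)
    also have "\<dots> \<in> sets N" by measurable
    finally show ?thesis .
  qed simp
qed

lemma measurable_dil [measurable]: "dil k \<in> measurable \<mu> \<mu>"
proof (rule measurable_vil)
  show "(\<lambda>x. dil k x j) \<in> measurable \<mu> (count_space UNIV)" for j
    unfolding dil_def by measurable
qed simp

lemma measurable_vadd [measurable]: "x \<in> vil p \<Longrightarrow> vadd p x \<in> measurable \<mu> \<mu>"
proof (rule measurable_vil)
  show "(\<lambda>y. vadd p x y j) \<in> measurable \<mu> (count_space UNIV)" for j
    unfolding vadd_def by (rule measurable_compose[OF measurable_coord, of "\<lambda>a. (x j + a) mod p"]) simp
qed simp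

lemma measurable_vsub [measurable]: "x \<in> vil p \<Longrightarrow> (\<lambda>y. vsub p y x) \<in> measurable \<mu> \<mu>"
proof (rule measurable_vil)
  show "(\<lambda>y. vsub p y x j) \<in> measurable \<mu> (count_space UNIV)" for j
    unfolding vsub_def by (rule measurable_compose[OF measurable_coord, of "\<lambda>a. (a + (p - x j)) mod p"]) simp
qed simp

section \<open>Haar measure of cosets, uniqueness, and behaviour under translation and
  dilation\<close>

lemma emeasure_cyl_eq:
  assumes "x \<in> vil p"
  shows "emeasure \<mu> (cyl p x n) = emeasure \<mu> (vnbh p n)"
proof -
  have "\<forall>x\<in>vil p. \<forall>E\<in>sets \<mu>. emeasure \<mu> (vadd p x ` E) = emeasure \<mu> E"
    using haar by (simp add: haar_measure_def)
  with assms have "emeasure \<mu> (vadd p x ` vnbh p n) = emeasure \<mu> (vnbh p n)"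
    by (simp only: sets_vnbh)
  then show ?thesis by (simp only: translate_vnbh[OF assms])
qed

text \<open>Splitting by the value of coordinate \<open>n + 1\<close> cuts \<open>vnbh p n\<close>
  into p cosets of \<open>vnbh p (n + 1)\<close>, which have equal measure by invariance.\<close>

lemma emeasure_vnbh_Suc: "emeasure \<mu> (vnbh p n) = of_nat p * emeasure \<mu> (vnbh p (n + 1))"
proof -
  let ?e = "\<lambda>a j. if j = n + 1 then a else (0::nat)"
  have e: "?e a \<in> vil p" if "a < p" for a
    using that by (auto simp: vil_def intro: exI[of _ "n + 1"])
  have "vnbh p n = (\<Union>a<p. cyl p (?e a) (n + 1))"
  proof (intro equalityI subsetI)
    fix x assume x: "x \<in> vnbh p n"
    then have "x \<in> cyl p (?e (x (n + 1))) (n + 1)" "x (n + 1) < p"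
      by (auto simp: cyl_def vnbh_def vil_def)
    then show "x \<in> (\<Union>a<p. cyl p (?e a) (n + 1))" by blast
  next
    fix x assume "x \<in> (\<Union>a<p. cyl p (?e a) (n + 1))"
    then obtain a where "x \<in> vil p" "\<And>j. j \<le> n + 1 \<Longrightarrow> x j = ?e a j"
      by (auto simp: cyl_def)
    then show "x \<in> vnbh p n"
      by (simp add: vnbh_def)
  qed
  also have "emeasure \<mu> \<dots> = (\<Sum>a<p. emeasure \<mu> (cyl p (?e a) (n + 1)))"
  proof (rule sum_emeasure[symmetric])
    show "disjoint_family_on (\<lambda>a. cyl p (?e a) (n + 1)) {..<p}"
    proof (clarsimp simp: disjoint_family_on_def)
      fix a b :: nat assume "a \<noteq> b"
      then show "cyl p (?e a) (n + 1) \<inter> cyl p (?e b) (n + 1) = {}"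
        unfolding cyl_def by (smt (verit) disjoint_iff mem_Collect_eq)
    qed
  qed auto
  also have "\<dots> = (\<Sum>a<p. emeasure \<mu> (vnbh p (n + 1)))"
    by (intro sum.cong refl emeasure_cyl_eq e) simp
  finally show ?thesis by simp
qed

lemma powi_add: "ennreal (real p powi (k + l)) = ennreal (real p powi k) * ennreal (real p powi l)"
proof -
  have "real p powi (k + l) = real p powi k * real p powi l"
    by (rule power_int_add) simp
  then show ?thesis by (simp only: ennreal_mult zero_le_power_int of_nat_0_le_iff)
qed

lemma powi_minus: "ennreal (real p powi (- k)) * ennreal (real p powi k) = 1"
  using powi_add[of "- k" k] by simp

lemma emeasure_vnbh: "emeasure \<mu> (vnbh p n) = ennreal (real p powi (- n))"
proof (induction n rule: int_induct[of _ 0])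
  case base
  then show ?case using haar by (simp add: haar_measure_def)
next
  case (step1 i)
  have "ennreal (real p) * emeasure \<mu> (vnbh p (i + 1)) = ennreal (real p powi (- i))"
    using emeasure_vnbh_Suc[of i] step1 by (simp only: ennreal_of_nat_eq_real_of_nat)
  also have "- i = 1 + (- (i + 1))" by simp
  also have "ennreal (real p powi (1 + (- (i + 1)))) = ennreal (real p) * ennreal (real p powi (- (i + 1)))"
    by (simp only: powi_add power_int_1_right)
  finally show ?case
    using p_pos by (simp only: ennreal_mult_cancel_left) simp
next
  case (step2 i)
  have "emeasure \<mu> (vnbh p (i - 1)) = ennreal (real p) * ennreal (real p powi (- i))"
    using emeasure_vnbh_Suc[of "i - 1"] step2 by (simp add: ennreal_of_nat_eq_real_of_nat)
  also have "\<dots> = ennreal (real p powi (1 + - i))"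
    by (simp only: powi_add power_int_1_right)
  also have "1 + - i = - (i - 1)" by simp
  finally show ?case .
qed

lemma emeasure_cyl: "x \<in> vil p \<Longrightarrow> emeasure \<mu> (cyl p x n) = ennreal (real p powi (- n))"
  by (simp add: emeasure_cyl_eq emeasure_vnbh)

lemma vil_eq_UN: "(\<Union>n. vnbh p (- int n)) = vil p"
proof (intro equalityI subsetI)
  fix x assume x: "x \<in> vil p"
  then obtain k where k: "\<forall>j<k. x j = 0" by (auto simp: vil_def)
  have "x \<in> vnbh p (- int (nat (1 - k)))"
    using x k by (auto simp: vnbh_def)
  then show "x \<in> (\<Union>n. vnbh p (- int n))" by blast
qed (auto simp: vnbh_def)

sublocale sigma_finite_measure \<mu>
proof
  show "\<exists>A. countable A \<and> A \<subseteq> sets \<mu> \<and> \<Union> A = space \<mu> \<and> (\<forall>a\<in>A. emeasure \<mu> a \<noteq> \<infinity>)"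
    by (rule exI[of _ "range (\<lambda>n. vnbh p (- int n))"])
      (auto simp: vil_eq_UN emeasure_vnbh simp flip: vnbh_eq_cyl)
qed

text \<open>Uniqueness on the pi-system of cosets, with the sets \<open>vnbh p (- int n)\<close> as
  an exhaustion by sets of finite measure. It reduces both transformation laws below to a check on
  cosets.\<close>

lemma mu_eqI:
  assumes "sets N = sets \<mu>" and "\<And>e n. e \<in> vil p \<Longrightarrow> emeasure N (cyl p e n) = emeasure \<mu> (cyl p e n)"
  shows "N = \<mu>"
proof (rule measure_eqI_generator_eq[OF Int_stable_cyls])
  show "insert {} (cyls p) \<subseteq> Pow (vil p)"
    using cyl_subset by (auto simp: cyls_def)
  show "emeasure N X = emeasure \<mu> X" if "X \<in> insert {} (cyls p)" for X
    using that assms(2) vfin_subset[of p] by (auto simp: cyls_def)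
  show "sets N = sigma_sets (vil p) (insert {} (cyls p))"
    "sets \<mu> = sigma_sets (vil p) (insert {} (cyls p))"
    using assms(1) sets_mu by auto
  show "range (\<lambda>n. vnbh p (- int n)) \<subseteq> insert {} (cyls p)"
    using cyl_in_cyls[OF zero_vil] by (auto simp: vnbh_eq_cyl)
  show "(\<Union>n. vnbh p (- int n)) = vil p" by (rule vil_eq_UN)
  show "emeasure N (vnbh p (- int i)) \<noteq> \<infinity>" for i
    by (simp add: vnbh_eq_cyl assms(2) emeasure_cyl)
qed

text \<open>Haar measure is defined by invariance for images of sets; change of variables in
  integrals wants the push-forward form.\<close>

lemma distr_vadd:
  assumes x: "x \<in> vil p"
  shows "distr \<mu> \<mu> (vadd p x) = \<mu>"
proof (rule mu_eqI)
  fix e n assume e: "e \<in> vil p"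
  have "vadd p x -` cyl p e n \<inter> space \<mu> = cyl p (vsub p e x) n"
  proof (intro equalityI subsetI)
    fix y assume "y \<in> vadd p x -` cyl p e n \<inter> space \<mu>"
    then have y: "y \<in> vil p" "\<And>j. j \<le> n \<Longrightarrow> vadd p x y j = e j" by (auto simp: cyl_def)
    have "y j = vsub p e x j" if "j \<le> n" for j
      using fun_cong[OF vsub_vadd[OF x y(1)], of j] y(2)[OF that]
      by (simp add: vsub_def vadd_commute[of x y])
    with y(1) show "y \<in> cyl p (vsub p e x) n" by (simp add: cyl_def)
  next
    fix y assume "y \<in> cyl p (vsub p e x) n"
    then have y: "y \<in> vil p" "\<And>j. j \<le> n \<Longrightarrow> y j = vsub p e x j" by (auto simp: cyl_def)
    have "vadd p x y j = e j" if "j \<le> n" for j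
      using fun_cong[OF vadd_vsub[OF x e], of j] y(2)[OF that] by (simp add: vadd_def)
    with x y(1) show "y \<in> vadd p x -` cyl p e n \<inter> space \<mu>" by (simp add: cyl_def)
  qed
  with x e show "emeasure (distr \<mu> \<mu> (vadd p x)) (cyl p e n) = emeasure \<mu> (cyl p e n)"
    by (simp add: emeasure_distr emeasure_cyl)
qed simp

lemma dil_vimage_cyl: "dil k -` cyl p e n \<inter> vil p = cyl p (dil (- k) e) (n + k)"
proof (intro equalityI subsetI)
  fix x assume "x \<in> dil k -` cyl p e n \<inter> vil p"
  then have x: "x \<in> vil p" "\<And>j. j \<le> n \<Longrightarrow> x (j + k) = e j" by (auto simp: cyl_def dil_def)
  then show "x \<in> cyl p (dil (- k) e) (n + k)"
    using x(2)[of "_ - k"] by (auto simp: cyl_def dil_def)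
qed (auto simp: cyl_def dil_def dil_vil[unfolded dil_def])

text \<open>The preimage of a coset of \<open>vnbh p n\<close> under \<open>dil k\<close> is a coset
  of \<open>vnbh p (n + k)\<close>. The push-forward therefore carries a factor p^(-k), which the
  density undoes.\<close>

lemma distr_dil: "density (distr \<mu> \<mu> (dil k)) (\<lambda>_. ennreal (real p powi k)) = \<mu>"
proof (rule mu_eqI)
  fix e n assume e: "e \<in> vil p"
  then show "emeasure (density (distr \<mu> \<mu> (dil k)) (\<lambda>_. ennreal (real p powi k))) (cyl p e n) =
      emeasure \<mu> (cyl p e n)"
    using powi_add[of k "- (n + k)"]
    by (simp add: emeasure_density_const emeasure_distr dil_vimage_cyl emeasure_cyl)
qed simp

lemma integral_vadd:
  fixes f :: "vseq \<Rightarrow> complex"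
  assumes "x \<in> vil p" "f \<in> borel_measurable \<mu>"
  shows "(\<integral>y. f (vadd p x y) \<partial>\<mu>) = (\<integral>y. f y \<partial>\<mu>)"
  using integral_distr[of "vadd p x" \<mu> \<mu> f] assms by (simp add: distr_vadd)

lemma nn_integral_dil:
  assumes [measurable]: "f \<in> borel_measurable \<mu>"
  shows "(\<integral>\<^sup>+x. f (dil k x) \<partial>\<mu>) = ennreal (real p powi (- k)) * (\<integral>\<^sup>+x. f x \<partial>\<mu>)"
proof -
  have "(\<integral>\<^sup>+x. f x \<partial>\<mu>) = (\<integral>\<^sup>+x. ennreal (real p powi k) * f (dil k x) \<partial>\<mu>)"
  proof -
    let ?D = "distr \<mu> \<mu> (dil k)"
    have "(\<integral>\<^sup>+x. f x \<partial>\<mu>) = (\<integral>\<^sup>+x. f x \<partial>density ?D (\<lambda>_. ennreal (real p powi k)))"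
      by (simp only: distr_dil)
    also have "\<dots> = (\<integral>\<^sup>+x. ennreal (real p powi k) * f x \<partial>?D)"
      by (rule nn_integral_density) auto
    also have "\<dots> = (\<integral>\<^sup>+x. ennreal (real p powi k) * f (dil k x) \<partial>\<mu>)"
      by (rule nn_integral_distr) auto
    finally show ?thesis .
  qed
  also have "\<dots> = ennreal (real p powi k) * (\<integral>\<^sup>+x. f (dil k x) \<partial>\<mu>)"
    by (rule nn_integral_cmult) measurable
  finally have "ennreal (real p powi (- k)) * (\<integral>\<^sup>+x. f x \<partial>\<mu>) =
      (ennreal (real p powi (- k)) * ennreal (real p powi k)) * (\<integral>\<^sup>+x. f (dil k x) \<partial>\<mu>)"
    by (simp add: mult.assoc)
  also have "ennreal (real p powi (- k)) * ennreal (real p powi k) = 1"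
    by (rule powi_minus)
  finally show ?thesis by simp
qed

lemma integral_dil:
  fixes f :: "vseq \<Rightarrow> complex"
  assumes [measurable]: "f \<in> borel_measurable \<mu>"
  shows "(\<integral>x. f (dil k x) \<partial>\<mu>) = real p powi (- k) *\<^sub>R (\<integral>x. f x \<partial>\<mu>)"
proof -
  have "(\<integral>x. f x \<partial>\<mu>) = (\<integral>x. (real p powi k) *\<^sub>R f (dil k x) \<partial>\<mu>)"
  proof -
    let ?D = "distr \<mu> \<mu> (dil k)"
    have "(\<integral>x. f x \<partial>\<mu>) = (\<integral>x. f x \<partial>density ?D (\<lambda>_. ennreal (real p powi k)))"
      by (simp only: distr_dil)
    also have "\<dots> = (\<integral>x. (real p powi k) *\<^sub>R f x \<partial>?D)"
      by (rule integral_density) auto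
    also have "\<dots> = (\<integral>x. (real p powi k) *\<^sub>R f (dil k x) \<partial>\<mu>)"
      by (rule integral_distr) auto
    finally show ?thesis .
  qed
  then show ?thesis
    by (simp add: power_int_minus)
qed

text \<open>Dilation scales measure by a constant and so pulls null sets back to null sets. Over the
  countably many integers \<open>k\<close> this makes an almost everywhere identity available along
  whole orbits.\<close>

lemma AE_dil:
  assumes "AE x in \<mu>. P x"
  shows "AE x in \<mu>. P (dil k x)"
proof -
  obtain N where N: "N \<in> null_sets \<mu>" "{x \<in> space \<mu>. \<not> P x} \<subseteq> N"
    using assms by (auto simp: eventually_ae_filter)
  then have [measurable]: "N \<in> sets \<mu>" by auto
  have "(\<integral>\<^sup>+x. indicator N (dil k x) \<partial>\<mu>) = ennreal (real p powi (- k)) * (\<integral>\<^sup>+x. indicator N x \<partial>\<mu>)"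
    by (rule nn_integral_dil) measurable
  also have "\<dots> = 0" using N(1) by (simp add: null_setsD1)
  finally have "AE x in \<mu>. indicator N (dil k x) = (0::ennreal)"
    by (subst (asm) nn_integral_0_iff_AE) auto
  with AE_space show ?thesis
  proof eventually_elim
    case (elim x)
    then have "dil k x \<in> vil p" "dil k x \<notin> N" by (auto split: split_indicator_asm)
    then show ?case using N(2) by (intro ccontr[of "P (dil k x)"]) (simp add: subset_eq)
  qed
qed

end

section \<open>Characters\<close>

text \<open>The standard character of Z/p lifted to natural numbers; it turns the sum in the
  exponent of \<open>chi\<close> into a product.\<close>

definition echar :: "nat \<Rightarrow> nat \<Rightarrow> complex" where
  "echar p n = exp (2 * of_real pi * \<i> / of_nat p * of_nat n)"

lemma echar_0 [simp]: "echar p 0 = 1"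
  by (simp add: echar_def)

lemma echar_add: "echar p (a + b) = echar p a * echar p b"
  by (simp add: echar_def ring_distribs exp_add)

lemma echar_sum: "echar p (\<Sum>j\<in>J. f j) = (\<Prod>j\<in>J. echar p (f j))"
  by (induction J rule: infinite_finite_induct) (simp_all add: echar_add)

lemma norm_echar [simp]: "cmod (echar p n) = 1"
  by (simp add: echar_def norm_exp_eq_Re)

lemma echar_eq_iff:
  assumes "0 < p"
  shows "echar p a = echar p b \<longleftrightarrow> a mod p = b mod p"
  using complex_root_unity_eq[of p a b] assms by (simp add: echar_def)

text \<open>The summation set in \<open>chi\<close> depends on both arguments. A common finite
  superset \<open>J\<close> allows values at different arguments to be multiplied and
  compared.\<close>

lemma chi_eq_echar:
  assumes "finite J" and "\<And>j. j \<notin> J \<Longrightarrow> x j * w (1 - j) = 0"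
  shows "chi p x w = echar p (\<Sum>j\<in>J. x j * w (1 - j))"
proof -
  have "(\<Sum>j | x j * w (1 - j) \<noteq> 0. x j * w (1 - j)) = (\<Sum>j\<in>J. x j * w (1 - j))"
  proof (rule sum.mono_neutral_left)
    show "{j. x j * w (1 - j) \<noteq> 0} \<subseteq> J"
    proof (rule subsetI, rule ccontr)
      fix j assume "j \<in> {j. x j * w (1 - j) \<noteq> 0}" "j \<notin> J"
      with assms(2)[of j] show False by simp
    qed
  qed (use assms(1) in auto)
  then show ?thesis by (simp only: chi_def echar_def)
qed

lemma norm_chi [simp]: "cmod (chi p x w) = 1"
  by (simp add: chi_def norm_exp_eq_Re)

lemma chi_mult_cnj [simp]: "chi p x w * cnj (chi p x w) = 1"
  by (simp add: complex_norm_square[symmetric])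

lemma chi_commute: "chi p x w = chi p w x"
proof -
  have "(\<Sum>j | x j * w (1 - j) \<noteq> 0. x j * w (1 - j)) = (\<Sum>j | w j * x (1 - j) \<noteq> 0. w j * x (1 - j))"
    by (rule sum.reindex_bij_witness[of _ "\<lambda>j. 1 - j" "\<lambda>j. 1 - j"]) auto
  then show ?thesis by (simp only: chi_def)
qed

text \<open>Because the pairing matches index j with 1 - j, shifting one argument amounts to the
  same shift, with the same sign, of the other.\<close>

lemma chi_dil: "chi p (dil k x) w = chi p x (dil k w)"
proof -
  have "(\<Sum>j | dil k x j * w (1 - j) \<noteq> 0. dil k x j * w (1 - j)) =
      (\<Sum>j | x j * dil k w (1 - j) \<noteq> 0. x j * dil k w (1 - j))"
    by (rule sum.reindex_bij_witness[of _ "\<lambda>j. j - k" "\<lambda>j. j + k"]) (auto simp: dil_def algebra_simps)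
  then show ?thesis by (simp only: chi_def)
qed

text \<open>\<open>vnbh p (- n)\<close> annihilates \<open>vnbh p n\<close>: for
  \<open>j > n\<close> the index \<open>1 - j\<close> is at most \<open>- n\<close>, where
  \<open>w\<close> vanishes. The local constancy of transforms rests on this.\<close>

lemma chi_cong:
  assumes "\<And>j. j \<le> n \<Longrightarrow> x j = y j" and "w \<in> vnbh p (- n)"
  shows "chi q x w = chi q y w"
proof -
  have "x j * w (1 - j) = y j * w (1 - j)" for j
    using assms by (cases "j \<le> n") (auto simp: vnbh_def)
  then show ?thesis by (simp only: chi_def)
qed

lemma borel_measurable_cnj [measurable (raw)]:
  "f \<in> borel_measurable M \<Longrightarrow> (\<lambda>x. cnj (f x)) \<in> borel_measurable M"
  by (erule measurable_compose) (intro borel_measurable_continuous_onI continuous_intros)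

context vilenkin
begin

lemma chi_vadd:
  assumes "x \<in> vil p" "w \<in> vil p" "v \<in> vil p"
  shows "chi p x (vadd p w v) = chi p x w * chi p x v"
proof -
  obtain a b c where abc: "\<And>j. j < a \<Longrightarrow> x j = 0" "\<And>j. j < b \<Longrightarrow> w j = 0" "\<And>j. j < c \<Longrightarrow> v j = 0"
    using assms unfolding vil_def by blast
  let ?J = "{a..1 - min b c}"
  have J: "x j = 0 \<or> (w (1 - j) = 0 \<and> v (1 - j) = 0)" if "j \<notin> ?J" for j
  proof (cases "j < a")
    case False
    with that have "1 - j < b" "1 - j < c" by auto
    then show ?thesis using abc by blast
  qed (use abc in blast)
  \<comment> \<open>Reducing a coordinate modulo p changes the exponent by a multiple of p, which a
    p-th root of unity does not see.\<close>
  have mod: "echar p (x j * vadd p w v (1 - j)) = echar p (x j * w (1 - j)) * echar p (x j * v (1 - j))" for j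
  proof -
    have "(x j * vadd p w v (1 - j)) mod p = (x j * w (1 - j) + x j * v (1 - j)) mod p"
      by (simp only: vadd_def mod_mult_right_eq ring_distribs)
    then have "echar p (x j * vadd p w v (1 - j)) = echar p (x j * w (1 - j) + x j * v (1 - j))"
      by (simp only: echar_eq_iff[OF p_pos])
    then show ?thesis by (simp only: echar_add)
  qed
  have eq: "chi p x u = (\<Prod>j\<in>?J. echar p (x j * u (1 - j)))"
    if "\<And>j. j \<notin> ?J \<Longrightarrow> x j * u (1 - j) = 0" for u
    unfolding echar_sum[symmetric] by (rule chi_eq_echar[OF finite_atLeastAtMost_int]) (rule that)
  have "chi p x (vadd p w v) = (\<Prod>j\<in>?J. echar p (x j * vadd p w v (1 - j)))"
  proof (rule eq)
    show "x j * vadd p w v (1 - j) = 0" if "j \<notin> ?J" for j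
      using J[OF that] by (auto simp: vadd_def)
  qed
  also have "\<dots> = (\<Prod>j\<in>?J. echar p (x j * w (1 - j))) * (\<Prod>j\<in>?J. echar p (x j * v (1 - j)))"
    by (simp only: mod prod.distrib)
  also have "(\<Prod>j\<in>?J. echar p (x j * w (1 - j))) = chi p x w"
  proof (rule eq[symmetric])
    show "x j * w (1 - j) = 0" if "j \<notin> ?J" for j
      using J[OF that] by auto
  qed
  also have "(\<Prod>j\<in>?J. echar p (x j * v (1 - j))) = chi p x v"
  proof (rule eq[symmetric])
    show "x j * v (1 - j) = 0" if "j \<notin> ?J" for j
      using J[OF that] by auto
  qed
  finally show ?thesis .
qed

text \<open>Joint measurability is the hypothesis of Fubini's theorem later on. At each pair the
  partial products are constant once the window \<open>{- int n..int n}\<close> contains every index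
  with a nonzero summand.\<close>

lemma measurable_chi_pair: "(\<lambda>z. chi p (fst z) (snd z)) \<in> borel_measurable (\<mu> \<Otimes>\<^sub>M \<mu>)"
proof (rule borel_measurable_LIMSEQ_metric)
  let ?f = "\<lambda>n z. \<Prod>j\<in>{- int n..int n}. echar p (fst z j * snd z (1 - j))"
  have *: "(\<lambda>z. echar p (fst z j * snd z (1 - j))) \<in> borel_measurable (\<mu> \<Otimes>\<^sub>M \<mu>)" for j
  proof (rule measurable_compose_countable[where f = "\<lambda>i z. echar p (i * snd z (1 - j))"])
    show "(\<lambda>z. fst z j) \<in> measurable (\<mu> \<Otimes>\<^sub>M \<mu>) (count_space UNIV)"
      by (rule measurable_compose[OF measurable_fst measurable_coord])
    fix i
    have "(\<lambda>z. snd z (1 - j)) \<in> measurable (\<mu> \<Otimes>\<^sub>M \<mu>) (count_space UNIV)"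
      by (rule measurable_compose[OF measurable_snd measurable_coord])
    then show "(\<lambda>z. echar p (i * snd z (1 - j))) \<in> borel_measurable (\<mu> \<Otimes>\<^sub>M \<mu>)"
      by (rule measurable_compose) simp
  qed
  show "?f n \<in> borel_measurable (\<mu> \<Otimes>\<^sub>M \<mu>)" for n
    by (intro borel_measurable_prod *)
  fix z assume "z \<in> space (\<mu> \<Otimes>\<^sub>M \<mu>)"
  then have "fst z \<in> vil p" "snd z \<in> vil p"
    by (auto simp: space_pair_measure)
  then obtain a b where ab: "\<And>j. j < a \<Longrightarrow> fst z j = 0" "\<And>j. j < b \<Longrightarrow> snd z j = 0"
    unfolding vil_def by blast
  have "?f n z = chi p (fst z) (snd z)" if "nat (max \<bar>a\<bar> \<bar>1 - b\<bar>) \<le> n" for n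
  proof -
    have "chi p (fst z) (snd z) = echar p (\<Sum>j\<in>{- int n..int n}. fst z j * snd z (1 - j))"
    proof (rule chi_eq_echar)
      fix j assume "j \<notin> {- int n..int n}"
      with that have "j < a \<or> 1 - j < b" by auto
      then show "fst z j * snd z (1 - j) = 0" using ab by auto
    qed simp
    then show ?thesis by (simp add: echar_sum)
  qed
  then show "(\<lambda>n. ?f n z) \<longlonglongrightarrow> chi p (fst z) (snd z)"
    by (intro tendsto_eventually eventually_sequentiallyI)
qed

lemma measurable_chi [measurable (raw)]:
  assumes "f \<in> measurable N \<mu>" "g \<in> measurable N \<mu>"
  shows "(\<lambda>x. chi p (f x) (g x)) \<in> borel_measurable N"
  using measurable_compose[OF measurable_Pair[OF assms] measurable_chi_pair] by simp

lemma measurable_chi_right [measurable]: "x \<in> vil p \<Longrightarrow> chi p x \<in> borel_measurable \<mu>"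
  by (rule measurable_chi[of "\<lambda>_. x" \<mu> "\<lambda>w. w"]) simp_all

lemma vadd_vnbh_iff:
  assumes "v \<in> vnbh p n" "w \<in> vil p"
  shows "vadd p v w \<in> vnbh p n \<longleftrightarrow> w \<in> vnbh p n"
  using assms by (auto simp: vnbh_def) (auto simp: vadd_def vil_def)

text \<open>Orthogonality of characters on \<open>vnbh p (- n)\<close>. Characters from one coset of
  \<open>vnbh p n\<close> agree there; otherwise translation by an element on which they differ
  multiplies the integral by a factor other than 1.\<close>

lemma integral_vnbh_chi:
  assumes x: "x \<in> vil p" and y: "y \<in> vil p"
  shows "(\<integral>w. indicator (vnbh p (- n)) w * (chi p x w * cnj (chi p y w)) \<partial>\<mu>) =
    of_real (real p powi n) * indicator (cyl p y n) x"
proof (cases "x \<in> cyl p y n")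
  case True
  have "chi p x w * cnj (chi p y w) = 1" if "w \<in> vnbh p (- n)" for w
    using chi_cong[of n x y w p p] that True by (simp add: cyl_def)
  then have "(\<integral>w. indicator (vnbh p (- n)) w * (chi p x w * cnj (chi p y w)) \<partial>\<mu>) =
      (\<integral>w. indicator (vnbh p (- n)) w \<partial>\<mu>)"
    by (intro Bochner_Integration.integral_cong) (auto split: split_indicator)
  also have "\<dots> = of_real (measure \<mu> (vnbh p (- n)))"
  proof -
    have "(\<integral>w. indicator (vnbh p (- n)) w \<partial>\<mu>) = (\<integral>w. of_real (indicator (vnbh p (- n)) w) \<partial>\<mu> :: complex)"
      by (intro Bochner_Integration.integral_cong) (auto split: split_indicator)
    also have "\<dots> = of_real (\<integral>w. indicator (vnbh p (- n)) w \<partial>\<mu>)"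
      by simp
    finally show ?thesis using sets.sets_into_space[OF sets_vnbh[of "-n"]] by (simp add: Int_absorb2)
  qed
  also have "measure \<mu> (vnbh p (- n)) = real p powi n"
    by (simp add: measure_def emeasure_vnbh)
  finally show ?thesis using True by simp
next
  case False
  then obtain k where k: "k \<le> n" "x k \<noteq> y k"
    using x by (auto simp: cyl_def)
  \<comment> \<open>Since \<open>k \<le> n\<close>, the position \<open>1 - k\<close> exceeds
    \<open>- n\<close>, so \<open>?v\<close> lies in the domain of integration; it evaluates both
    characters at coordinate \<open>k\<close>, where they differ.\<close>
  let ?v = "vunit (1 - k)"
  let ?g = "\<lambda>w. indicator (vnbh p (- n)) w * (chi p x w * cnj (chi p y w))"
  have v: "?v \<in> vnbh p (- n)"
    using k(1) vunit_vil[of "1 - k"] by (auto simp: vnbh_def vunit_def)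
  have chi_v: "chi p z ?v = echar p (z k)" for z
    by (subst chi_eq_echar[of "{k}"]) (auto simp: vunit_def)
  have "chi p x ?v \<noteq> chi p y ?v"
    using k(2) x y by (simp add: chi_v echar_eq_iff vil_def)
  then have c: "chi p x ?v * cnj (chi p y ?v) \<noteq> 1"
  proof -
    have e: "chi p x ?v = (chi p x ?v * cnj (chi p y ?v)) * chi p y ?v"
    proof -
      have "(chi p x ?v * cnj (chi p y ?v)) * chi p y ?v = chi p x ?v * (chi p y ?v * cnj (chi p y ?v))"
        by (simp only: mult_ac)
      then show ?thesis by simp
    qed
    show ?thesis
    proof
      assume "chi p x ?v * cnj (chi p y ?v) = 1"
      with e have "chi p x ?v = chi p y ?v" by (simp only: mult_1)
      with \<open>chi p x ?v \<noteq> chi p y ?v\<close> show False ..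
    qed
  qed
  have g: "?g \<in> borel_measurable \<mu>"
    by (intro borel_measurable_times borel_measurable_cnj measurable_chi_right x y borel_measurable_indicator sets_vnbh)
  have "(\<integral>w. ?g w \<partial>\<mu>) = (\<integral>w. ?g (vadd p ?v w) \<partial>\<mu>)"
    by (rule integral_vadd[symmetric, OF vunit_vil g])
  also have "\<dots> = (\<integral>w. (chi p x ?v * cnj (chi p y ?v)) * ?g w \<partial>\<mu>)"
    using x y v by (intro Bochner_Integration.integral_cong refl)
      (auto simp: chi_vadd vadd_vnbh_iff split: split_indicator)
  also have "\<dots> = (chi p x ?v * cnj (chi p y ?v)) * (\<integral>w. ?g w \<partial>\<mu>)"
    by simp
  finally have "(\<integral>w. ?g w \<partial>\<mu>) = 0"
    using c by (metis (no_types, lifting) mult_cancel_right1)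
  then show ?thesis using False by simp
qed

end

section \<open>Square integrable functions\<close>

text \<open>The squared L2 norm, with values in \<open>ennreal\<close> so that estimates can be
  stated before integrability is known.\<close>

definition sqn :: "'a measure \<Rightarrow> ('a \<Rightarrow> complex) \<Rightarrow> ennreal" where
  "sqn M f = (\<integral>\<^sup>+x. ennreal ((cmod (f x))\<^sup>2) \<partial>M)"

lemma L2_iff: "f \<in> L2 M \<longleftrightarrow> f \<in> borel_measurable M \<and> sqn M f < \<infinity>"
  by (auto simp: L2_def sqn_def integrable_iff_bounded)

lemma L2D [measurable_dest]: "f \<in> L2 M \<Longrightarrow> f \<in> borel_measurable M"
  by (simp add: L2_iff)

lemma L2_tendsto_iff: "L2_tendsto M g f \<longleftrightarrow> (\<lambda>n. sqn M (\<lambda>x. g n x - f x)) \<longlonglongrightarrow> 0"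
  by (simp add: L2_tendsto_def sqn_def)

lemma sqn_integral: "f \<in> L2 M \<Longrightarrow> ennreal (\<integral>x. (cmod (f x))\<^sup>2 \<partial>M) = sqn M f"
  unfolding sqn_def by (rule nn_integral_eq_integral[symmetric]) (auto simp: L2_def)

lemma norm_add_sq_le: "(cmod (a + b))\<^sup>2 \<le> 2 * (cmod a)\<^sup>2 + 2 * (cmod b)\<^sup>2"
proof -
  have "(cmod (a + b))\<^sup>2 \<le> (cmod a + cmod b)\<^sup>2"
    by (intro power_mono norm_triangle_ineq) simp
  also have "\<dots> \<le> 2 * (cmod a)\<^sup>2 + 2 * (cmod b)\<^sup>2"
    using zero_le_power2[of "cmod a - cmod b"] by (simp add: power2_eq_square algebra_simps)
  finally show ?thesis .
qed

text \<open>The triangle inequality for squared norms. Its factor 2 is immaterial for limits and,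
  used twice, is the source of the constant 4 in the lower bound for transforms.\<close>

lemma sqn_add_le:
  assumes [measurable]: "f \<in> borel_measurable M" "g \<in> borel_measurable M"
  shows "sqn M (\<lambda>x. f x + g x) \<le> 2 * sqn M f + 2 * sqn M g"
proof -
  have "sqn M (\<lambda>x. f x + g x) \<le> (\<integral>\<^sup>+x. 2 * ennreal ((cmod (f x))\<^sup>2) + 2 * ennreal ((cmod (g x))\<^sup>2) \<partial>M)"
    unfolding sqn_def
  proof (rule nn_integral_mono)
    fix x
    have "ennreal ((cmod (f x + g x))\<^sup>2) \<le> ennreal (2 * (cmod (f x))\<^sup>2 + 2 * (cmod (g x))\<^sup>2)"
      by (rule ennreal_leI[OF norm_add_sq_le])
    then show "ennreal ((cmod (f x + g x))\<^sup>2) \<le> 2 * ennreal ((cmod (f x))\<^sup>2) + 2 * ennreal ((cmod (g x))\<^sup>2)"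
      by (simp add: ennreal_plus ennreal_mult)
  qed
  also have "\<dots> = 2 * sqn M f + 2 * sqn M g"
    unfolding sqn_def by (subst nn_integral_add) (auto simp: nn_integral_cmult)
  finally show ?thesis .
qed

lemma sqn_minus_commute: "sqn M (\<lambda>x. f x - g x) = sqn M (\<lambda>x. g x - f x)"
  by (simp add: sqn_def norm_minus_commute)

lemma sqn_triangle:
  assumes [measurable]: "f \<in> borel_measurable M" "g \<in> borel_measurable M" "h \<in> borel_measurable M"
  shows "sqn M (\<lambda>x. f x - h x) \<le> 2 * sqn M (\<lambda>x. f x - g x) + 2 * sqn M (\<lambda>x. g x - h x)"
  using sqn_add_le[of "\<lambda>x. f x - g x" M "\<lambda>x. g x - h x"] by simp

lemma sqn_mono:
  assumes "\<And>x. x \<in> space M \<Longrightarrow> cmod (f x) \<le> cmod (g x)"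
  shows "sqn M f \<le> sqn M g"
  unfolding sqn_def by (intro nn_integral_mono ennreal_leI power_mono assms) auto

lemma sqn_cnj [simp]: "sqn M (\<lambda>x. cnj (f x)) = sqn M f"
  by (simp add: sqn_def)

lemma sqn_cnj_diff [simp]: "sqn M (\<lambda>x. cnj (f x) - cnj (g x)) = sqn M (\<lambda>x. f x - g x)"
  by (simp add: sqn_def complex_cnj_diff[symmetric] del: complex_cnj_diff)

lemma L2_diff:
  assumes "f \<in> L2 M" "g \<in> L2 M"
  shows "(\<lambda>x. f x - g x) \<in> L2 M"
proof -
  have "sqn M (\<lambda>x. f x - g x) \<le> 2 * sqn M f + 2 * sqn M g"
    using sqn_add_le[of f M "\<lambda>x. - g x"] assms by (simp add: L2_iff sqn_def)
  also have "\<dots> < \<infinity>"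
    using assms by (auto simp: L2_iff ennreal_mult_less_top)
  finally show ?thesis using assms by (auto simp: L2_iff)
qed

lemma L2_cnj: "f \<in> L2 M \<Longrightarrow> (\<lambda>x. cnj (f x)) \<in> L2 M"
  by (auto simp: L2_iff)

lemma L2_indicator:
  "f \<in> L2 M \<Longrightarrow> A \<in> sets M \<Longrightarrow> (\<lambda>x. indicator A x * f x) \<in> L2 M"
  unfolding L2_iff
  by (auto intro: le_less_trans[OF sqn_mono[of M "\<lambda>x. indicator A x * f x" f]]
      simp: norm_mult split: split_indicator)

lemma integrable_indicator_L2:
  assumes f: "f \<in> L2 M" and A [measurable]: "A \<in> sets M" and fin: "emeasure M A < \<infinity>"
  shows "integrable M (\<lambda>x. indicator A x * f x)"
proof (rule Bochner_Integration.integrable_bound)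
  show "integrable M (\<lambda>x. indicator A x + (cmod (f x))\<^sup>2 :: real)"
    using f fin by (auto simp: L2_def)
  show "(\<lambda>x. indicator A x * f x) \<in> borel_measurable M"
    using f by (auto simp: L2_iff)
  have "cmod (f x) \<le> 1 + (cmod (f x))\<^sup>2" for x
    using zero_le_power2[of "cmod (f x) - 1 / 2"] by (simp add: power2_diff field_simps)
  then show "AE x in M. norm (indicator A x * f x) \<le> norm (indicator A x + (cmod (f x))\<^sup>2)"
    by (auto simp: norm_mult split: split_indicator)
qed

lemma integrable_L2_mult:
  assumes f: "f \<in> L2 M" and g: "g \<in> L2 M"
  shows "integrable M (\<lambda>x. f x * g x)"
proof (rule Bochner_Integration.integrable_bound)
  show "integrable M (\<lambda>x. (cmod (f x))\<^sup>2 + (cmod (g x))\<^sup>2)"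
    using f g by (auto simp: L2_def)
  show "(\<lambda>x. f x * g x) \<in> borel_measurable M"
    using f g by (auto simp: L2_iff)
  have "cmod (f x) * cmod (g x) \<le> (cmod (f x))\<^sup>2 + (cmod (g x))\<^sup>2" for x
  proof -
    have "0 \<le> cmod (f x) * cmod (g x)" by simp
    then show ?thesis
      using sum_squares_bound[of "cmod (f x)" "cmod (g x)"] by linarith
  qed
  then show "AE x in M. norm (f x * g x) \<le> norm ((cmod (f x))\<^sup>2 + (cmod (g x))\<^sup>2)"
    by (auto simp: norm_mult)
qed

lemma Cauchy_Schwarz_L2:
  assumes f: "f \<in> L2 M" and g: "g \<in> L2 M"
  shows "ennreal ((cmod (\<integral>x. f x * g x \<partial>M))\<^sup>2) \<le> sqn M f * sqn M g"
proof -
  have [measurable]: "f \<in> borel_measurable M" "g \<in> borel_measurable M"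
    using f g by (auto simp: L2_iff)
  have "ennreal (cmod (\<integral>x. f x * g x \<partial>M)) \<le> (\<integral>\<^sup>+x. ennreal (cmod (f x)) * ennreal (cmod (g x)) \<partial>M)"
    using integral_norm_bound_ennreal[OF integrable_L2_mult[OF f g]]
    by (simp add: norm_mult ennreal_mult)
  then have "(ennreal (cmod (\<integral>x. f x * g x \<partial>M)))\<^sup>2 \<le> (\<integral>\<^sup>+x. ennreal (cmod (f x)) * ennreal (cmod (g x)) \<partial>M)\<^sup>2"
    by (rule power_mono) simp
  also have "\<dots> \<le> (\<integral>\<^sup>+x. (ennreal (cmod (f x)))\<^sup>2 \<partial>M) * (\<integral>\<^sup>+x. (ennreal (cmod (g x)))\<^sup>2 \<partial>M)"
    by (rule Cauchy_Schwarz_nn_integral) auto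
  finally show ?thesis
    by (simp add: sqn_def ennreal_power)
qed

text \<open>By Cauchy-Schwarz applied to the difference of \<open>g n\<close> and \<open>h\<close>.
  It extends the multiplication formula from integrable functions to all of L2.\<close>

lemma L2_tendsto_inner:
  assumes f: "f \<in> L2 M" and g: "\<And>n. g n \<in> L2 M" and h: "h \<in> L2 M" and lim: "L2_tendsto M g h"
  shows "(\<lambda>n. \<integral>x. f x * cnj (g n x) \<partial>M) \<longlonglongrightarrow> (\<integral>x. f x * cnj (h x) \<partial>M)"
proof -
  let ?d = "\<lambda>n. (\<integral>x. f x * cnj (g n x) \<partial>M) - (\<integral>x. f x * cnj (h x) \<partial>M)"
  have "ennreal ((cmod (?d n))\<^sup>2) \<le> sqn M f * sqn M (\<lambda>x. g n x - h x)" for n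
  proof -
    have "?d n = (\<integral>x. f x * cnj (g n x - h x) \<partial>M)"
      using integrable_L2_mult[OF f L2_cnj[OF g]] integrable_L2_mult[OF f L2_cnj[OF h]]
      by (simp add: right_diff_distrib)
    then show ?thesis
      using Cauchy_Schwarz_L2[OF f L2_cnj[OF L2_diff[OF g h]], of n] by simp
  qed
  then have le: "\<forall>\<^sub>F n in sequentially. ennreal ((cmod (?d n))\<^sup>2) \<le> sqn M f * sqn M (\<lambda>x. g n x - h x)"
    by (intro always_eventually allI)
  have "(\<lambda>n. sqn M f * sqn M (\<lambda>x. g n x - h x)) \<longlonglongrightarrow> sqn M f * 0"
    using lim f unfolding L2_tendsto_iff by (intro ennreal_tendsto_cmult) (auto simp: L2_iff)
  then have "(\<lambda>n. ennreal ((cmod (?d n))\<^sup>2)) \<longlonglongrightarrow> 0"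
    by (intro tendsto_sandwich[OF _ le tendsto_const]) (simp_all add: always_eventually)
  then have "(\<lambda>n. (cmod (?d n))\<^sup>2) \<longlonglongrightarrow> 0"
    using tendsto_ennreal_iff[of "\<lambda>n. (cmod (?d n))\<^sup>2" sequentially 0] by simp
  then have "(\<lambda>n. sqrt ((cmod (?d n))\<^sup>2)) \<longlonglongrightarrow> sqrt 0"
    by (rule tendsto_real_sqrt)
  then have "?d \<longlonglongrightarrow> 0"
    by (simp add: tendsto_norm_zero_iff)
  then show ?thesis
    by (rule LIM_zero_cancel)
qed

lemma tendsto_0_if_le_powers:
  fixes f :: "nat \<Rightarrow> ennreal"
  assumes "\<And>k. \<forall>\<^sub>F n in sequentially. f n \<le> ennreal ((1/8) ^ k)"
  shows "f \<longlonglongrightarrow> 0"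
proof (rule order_tendstoI)
  fix a :: ennreal assume a: "0 < a"
  have "(\<lambda>k. ennreal ((1/8) ^ k)) \<longlonglongrightarrow> ennreal 0"
    by (intro tendsto_ennrealI LIMSEQ_power_zero) simp
  then have "\<forall>\<^sub>F k in sequentially. ennreal ((1/8) ^ k) < a"
    using a by (intro order_tendstoD(2)[of _ "ennreal 0"]) auto
  then obtain k where "ennreal ((1/8) ^ k) < a"
    by (meson eventually_happens sequentially_bot)
  with assms[of k] show "\<forall>\<^sub>F n in sequentially. f n < a"
    by (auto elim!: eventually_mono)
qed auto

text \<open>Riesz-Fischer: a rapidly Cauchy subsequence converges almost everywhere, and Fatou's
  lemma shows that the pointwise limit is the limit in norm of the whole sequence.\<close>

lemma L2_complete:
  assumes g: "\<And>n. g n \<in> L2 M"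
    and cauchy: "\<And>e. 0 < e \<Longrightarrow> \<exists>N. \<forall>m\<ge>N. \<forall>n\<ge>N. sqn M (\<lambda>x. g m x - g n x) \<le> ennreal e"
  obtains F where "F \<in> L2 M" "L2_tendsto M g F"
proof -
  have [measurable]: "g n \<in> borel_measurable M" for n
    using g by (simp add: L2_iff)
  \<comment> \<open>The rate 1/8 leaves room for the weights 4^k below: the weighted squares of the
    increments have integrals at most (1/2)^k, and a finite weighted sum forces the increments
    eventually below (1/2)^k.\<close>
  obtain N where N: "\<And>k m n. m \<ge> N k \<Longrightarrow> n \<ge> N k \<Longrightarrow> sqn M (\<lambda>x. g m x - g n x) \<le> ennreal ((1/8) ^ k)"
    using cauchy[of "(1/8) ^ k" for k] by (auto simp: choice_iff) metis
  \<comment> \<open>Partial sums make the indices monotone, so that \<open>R l\<close> is beyond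
    \<open>N k\<close> for every \<open>k \<le> l\<close>.\<close>
  define R where "R k = (\<Sum>i\<le>k. N i)" for k
  have RN: "N k \<le> R l" if "k \<le> l" for k l
    unfolding R_def using that by (intro member_le_sum) auto
  let ?D = "\<lambda>k x. g (R (Suc k)) x - g (R k) x"
  have D: "sqn M (?D k) \<le> ennreal ((1/8) ^ k)" for k
    by (intro N RN) auto
  have "(\<integral>\<^sup>+x. (\<Sum>k. ennreal (4 ^ k * (cmod (?D k x))\<^sup>2)) \<partial>M) = (\<Sum>k. \<integral>\<^sup>+x. ennreal (4 ^ k * (cmod (?D k x))\<^sup>2) \<partial>M)"
    by (rule nn_integral_suminf) measurable
  also have "\<dots> \<le> (\<Sum>k. ennreal ((1/2) ^ k))"
  proof (rule suminf_le)
    fix k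
    have "(\<integral>\<^sup>+x. ennreal (4 ^ k * (cmod (?D k x))\<^sup>2) \<partial>M) = ennreal (4 ^ k) * sqn M (?D k)"
      unfolding sqn_def by (subst nn_integral_cmult[symmetric]) (auto simp: ennreal_mult)
    also have "\<dots> \<le> ennreal (4 ^ k) * ennreal ((1/8) ^ k)"
      by (intro mult_left_mono D) simp
    also have "\<dots> = ennreal ((1/2) ^ k)"
      by (simp add: ennreal_mult[symmetric] power_mult_distrib[symmetric])
    finally show "(\<integral>\<^sup>+x. ennreal (4 ^ k * (cmod (?D k x))\<^sup>2) \<partial>M) \<le> ennreal ((1/2) ^ k)" .
  qed auto
  also have "\<dots> = ennreal (\<Sum>k. (1/2) ^ k)"
    by (rule suminf_ennreal2) (auto intro: summable_geometric)
  finally have "(\<integral>\<^sup>+x. (\<Sum>k. ennreal (4 ^ k * (cmod (?D k x))\<^sup>2)) \<partial>M) \<noteq> \<infinity>"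
    by (auto simp: top_unique)
  then have "AE x in M. (\<Sum>k. ennreal (4 ^ k * (cmod (?D k x))\<^sup>2)) \<noteq> \<infinity>"
    by (rule nn_integral_noteq_infinite[rotated]) measurable
  then have conv: "AE x in M. convergent (\<lambda>k. g (R k) x)"
  proof eventually_elim
    case (elim x)
    then have "summable (\<lambda>k. 4 ^ k * (cmod (?D k x))\<^sup>2)"
      by (intro summable_suminf_not_top) auto
    then have "(\<lambda>k. 4 ^ k * (cmod (?D k x))\<^sup>2) \<longlonglongrightarrow> 0"
      by (rule summable_LIMSEQ_zero)
    then have "eventually (\<lambda>k. 4 ^ k * (cmod (?D k x))\<^sup>2 < 1) sequentially"
      by (rule order_tendstoD) simp
    then have "eventually (\<lambda>k. norm (?D k x) \<le> (1/2) ^ k) sequentially"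
    proof eventually_elim
      case (elim k)
      have "(cmod (?D k x))\<^sup>2 \<le> ((1/2) ^ k)\<^sup>2"
      proof -
        have "((1/2::real) ^ k)\<^sup>2 = 1 / 4 ^ k"
          by (simp add: power2_eq_square power_mult_distrib[symmetric] power_one_over)
        with elim show ?thesis by (simp add: pos_le_divide_eq mult.commute)
      qed
      then show ?case
        by (rule power2_le_imp_le) simp
    qed
    then have "summable (\<lambda>k. ?D k x)"
      by (rule summable_comparison_test_ev) (auto intro: summable_geometric)
    then have "convergent (\<lambda>n. \<Sum>k<n. ?D k x)"
      by (simp add: summable_iff_convergent)
    then have "convergent (\<lambda>n. (\<Sum>k<n. ?D k x) + g (R 0) x)"
      by (intro convergent_add convergent_const)
    moreover have "(\<Sum>k<n. ?D k x) + g (R 0) x = g (R n) x" for n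
      by (simp add: sum_lessThan_telescope[of "\<lambda>k. g (R k) x"])
    ultimately show ?case by simp
  qed
  \<comment> \<open>\<open>lim\<close> returns an arbitrary value at points of divergence, which
    form a null set by \<open>conv\<close>.\<close>
  define F where "F x = lim (\<lambda>k. g (R k) x)" for x
  have [measurable]: "F \<in> borel_measurable M"
    unfolding F_def by measurable
  have close: "sqn M (\<lambda>x. F x - g n x) \<le> ennreal ((1/8) ^ k)" if n: "n \<ge> N k" for k n
  proof -
    have "AE x in M. ennreal ((cmod (F x - g n x))\<^sup>2) = liminf (\<lambda>k. ennreal ((cmod (g (R k) x - g n x))\<^sup>2))"
      using conv
    proof eventually_elim
      case (elim x)
      then have "(\<lambda>k. g (R k) x) \<longlonglongrightarrow> F x"
        unfolding F_def by (simp add: convergent_LIMSEQ_iff)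
      then have "(\<lambda>k. ennreal ((cmod (g (R k) x - g n x))\<^sup>2)) \<longlonglongrightarrow> ennreal ((cmod (F x - g n x))\<^sup>2)"
        by (intro tendsto_ennrealI tendsto_intros)
      then show ?case
        by (intro lim_imp_Liminf[symmetric]) auto
    qed
    then have "sqn M (\<lambda>x. F x - g n x) = (\<integral>\<^sup>+x. liminf (\<lambda>k. ennreal ((cmod (g (R k) x - g n x))\<^sup>2)) \<partial>M)"
      unfolding sqn_def by (rule nn_integral_cong_AE)
    also have "\<dots> \<le> liminf (\<lambda>k. sqn M (\<lambda>x. g (R k) x - g n x))"
      unfolding sqn_def by (rule nn_integral_liminf) measurable
    also have "\<dots> \<le> liminf (\<lambda>_::nat. ennreal ((1/8) ^ k))"
    proof (rule Liminf_mono)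
      show "\<forall>\<^sub>F l in sequentially. sqn M (\<lambda>x. g (R l) x - g n x) \<le> ennreal ((1/8) ^ k)"
        using eventually_ge_at_top[of k]
        by eventually_elim (intro N RN n)
    qed
    finally show ?thesis by (simp add: Liminf_const)
  qed
  \<comment> \<open>At \<open>k = 0\<close> the squared distance to \<open>g (N 0)\<close> is at
    most 1, which puts the limit in L2.\<close>
  have "(\<lambda>x. F x - g (N 0) x) \<in> L2 M"
    using close[of 0 "N 0"] by (auto simp: L2_iff less_top[symmetric] top_unique)
  then have "(\<lambda>x. (F x - g (N 0) x) - (- g (N 0) x)) \<in> L2 M"
    by (rule L2_diff) (use g[of "N 0"] in \<open>simp add: L2_iff sqn_def\<close>)
  then have "F \<in> L2 M" by simp
  moreover have "L2_tendsto M g F"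
    unfolding L2_tendsto_iff
  proof (rule tendsto_0_if_le_powers)
    show "\<forall>\<^sub>F n in sequentially. sqn M (\<lambda>x. g n x - F x) \<le> ennreal ((1/8) ^ k)" for k
      using eventually_ge_at_top[of "N k"] by eventually_elim (use close in \<open>simp add: sqn_minus_commute[of M _ F]\<close>)
  qed
  ultimately show ?thesis by (rule that)
qed

section \<open>The integral transform of integrable functions and its norm inequalities\<close>

context vilenkin
begin

sublocale pair: pair_sigma_finite \<mu> \<mu> ..

text \<open>The transform with the unconjugated character, which makes functions on the group from
  data on the dual; the frame is tested on functions of this form. As \<open>chi\<close> is
  symmetric, one formula serves both sides.\<close>

definition ift :: "(vseq \<Rightarrow> complex) \<Rightarrow> vseq \<Rightarrow> complex" where
  "ift T w = (\<integral>x. T x * chi p x w \<partial>\<mu>)"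

lemma fourier_L1_eq: "fourier_L1 p \<mu> T w = cnj (ift (\<lambda>x. cnj (T x)) w)"
  unfolding fourier_L1_def ift_def by (subst Bochner_Integration.integral_cnj[symmetric]) simp

lemma borel_measurable_ift [measurable]:
  assumes [measurable]: "T \<in> borel_measurable \<mu>"
  shows "ift T \<in> borel_measurable \<mu>"
proof -
  have "(\<lambda>z. T (snd z) * chi p (snd z) (fst z)) \<in> borel_measurable (\<mu> \<Otimes>\<^sub>M \<mu>)"
    by (intro borel_measurable_times measurable_chi measurable_fst measurable_snd
        measurable_compose[OF measurable_snd assms])
  then have "(\<lambda>w. \<integral>x. T x * chi p x w \<partial>\<mu>) \<in> borel_measurable \<mu>"
    by (intro borel_measurable_lebesgue_integral) (simp add: case_prod_beta')
  then show ?thesis unfolding ift_def[abs_def] .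
qed

lemma borel_measurable_fourier_L1:
  "T \<in> borel_measurable \<mu> \<Longrightarrow> fourier_L1 p \<mu> T \<in> borel_measurable \<mu>"
  unfolding fourier_L1_eq[abs_def] by (intro borel_measurable_cnj borel_measurable_ift)

lemma integrable_mult_unit:
  fixes f c :: "vseq \<Rightarrow> complex"
  assumes "integrable \<mu> f" "c \<in> borel_measurable \<mu>" "\<And>x. x \<in> vil p \<Longrightarrow> cmod (c x) \<le> 1"
  shows "integrable \<mu> (\<lambda>x. f x * c x)"
proof (rule Bochner_Integration.integrable_bound[OF assms(1)])
  show "(\<lambda>x. f x * c x) \<in> borel_measurable \<mu>"
    using assms by (intro borel_measurable_times) auto
  show "AE x in \<mu>. norm (f x * c x) \<le> norm (f x)"
    using assms(3) by (intro AE_I2) (simp add: norm_mult mult_left_le)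
qed

lemma integrable_mult_chi:
  assumes "integrable \<mu> T" "w \<in> vil p"
  shows "integrable \<mu> (\<lambda>x. T x * chi p x w)"
  using assms by (intro integrable_mult_unit)
    (simp_all add: chi_commute[of p _ w] measurable_chi_right)

lemma norm_ift_le:
  assumes "w \<in> vil p" "integrable \<mu> T"
  shows "cmod (ift T w) \<le> (\<integral>x. cmod (T x) \<partial>\<mu>)"
proof -
  have "cmod (ift T w) \<le> (\<integral>x. cmod (T x * chi p x w) \<partial>\<mu>)"
    unfolding ift_def by (rule integral_norm_bound)
  then show ?thesis by (simp add: norm_mult)
qed

text \<open>Fubini for \<open>T x * S w * chi p x w\<close>, using the symmetry of
  \<open>chi\<close>. Both the norm inequalities and the transfer of frame coefficients reduce to
  this identity.\<close>

lemma ift_mult_formula: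
  assumes S: "integrable \<mu> S" and T: "integrable \<mu> T"
  shows "(\<integral>w. S w * ift T w \<partial>\<mu>) = (\<integral>x. T x * ift S x \<partial>\<mu>)"
proof -
  let ?f = "\<lambda>x w. T x * S w * chi p x w"
  have Sm: "S \<in> borel_measurable \<mu>" and Tm: "T \<in> borel_measurable \<mu>"
    using S T by auto
  have int: "integrable (\<mu> \<Otimes>\<^sub>M \<mu>) (case_prod ?f)"
  proof (rule pair.Fubini_integrable)
    show "case_prod ?f \<in> borel_measurable (\<mu> \<Otimes>\<^sub>M \<mu>)"
      unfolding case_prod_beta'
      by (intro borel_measurable_times measurable_chi measurable_fst measurable_snd
          measurable_compose[OF measurable_snd Sm] measurable_compose[OF measurable_fst Tm])
    have "integrable \<mu> (\<lambda>x. cmod (T x) * (\<integral>w. cmod (S w) \<partial>\<mu>))"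
      using T by simp
    then show "integrable \<mu> (\<lambda>x. \<integral>w. norm (case_prod ?f (x, w)) \<partial>\<mu>)"
      by (simp add: norm_mult)
    show "AE x in \<mu>. integrable \<mu> (\<lambda>w. case_prod ?f (x, w))"
    proof (rule AE_I2)
      fix x assume "x \<in> space \<mu>"
      then have "integrable \<mu> (\<lambda>w. T x * (S w * chi p x w))"
        using integrable_mult_chi[OF S] by (simp add: chi_commute[of p x])
      then show "integrable \<mu> (\<lambda>w. case_prod ?f (x, w))"
        by (simp add: mult.assoc)
    qed
  qed
  have "(\<integral>w. S w * ift T w \<partial>\<mu>) = (\<integral>w. (\<integral>x. ?f x w \<partial>\<mu>) \<partial>\<mu>)"
    unfolding ift_def by (simp add: mult_ac flip: integral_mult_right_zero)
  also have "\<dots> = (\<integral>x. (\<integral>w. ?f x w \<partial>\<mu>) \<partial>\<mu>)"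
    by (rule pair.Fubini_integral[OF int])
  also have "\<dots> = (\<integral>x. T x * ift S x \<partial>\<mu>)"
    unfolding ift_def by (simp add: mult.assoc chi_commute[of p _ "_::vseq"] flip: integral_mult_right_zero)
  finally show ?thesis .
qed

lemma emeasure_vnbh_finite [simp]: "emeasure \<mu> (vnbh p n) < top"
  by (simp add: emeasure_vnbh)

lemma integrable_indicator_bounded:
  assumes "f \<in> borel_measurable \<mu>" "\<And>x. x \<in> vil p \<Longrightarrow> cmod (f x) \<le> C"
    and "A \<in> sets \<mu>" "emeasure \<mu> A < \<infinity>"
  shows "integrable \<mu> (\<lambda>x. indicator A x * f x)"
proof (rule Bochner_Integration.integrable_bound)
  show "integrable \<mu> (\<lambda>x. indicator A x * C)"
    using assms by simp
  show "(\<lambda>x. indicator A x * f x) \<in> borel_measurable \<mu>"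
    using assms by simp
  show "AE x in \<mu>. norm (indicator A x * f x) \<le> norm (indicator A x * C)"
    using assms(2) by (intro AE_I2) (auto split: split_indicator intro: order_trans[OF _ abs_ge_self])
qed

text \<open>Over \<open>vnbh p (- n)\<close> the characters integrate to the averaging kernel of the cosets of
  \<open>vnbh p n\<close>.\<close>

lemma integral_vnbh_ift_sq:
  assumes T: "integrable \<mu> T"
  shows "(\<integral>w. indicator (vnbh p (- n)) w * (ift T w * cnj (ift T w)) \<partial>\<mu>) =
    (\<integral>y. cnj (T y) * (\<integral>x. of_real (real p powi n) * indicator (cyl p y n) x * T x \<partial>\<mu>) \<partial>\<mu>)"
proof -
  let ?K = "\<lambda>w. indicator (vnbh p (- n)) w :: complex"
  \<comment> \<open>The multiplication formula is applied twice: it moves one transform from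
    \<open>T\<close> to \<open>S\<close>, and inside \<open>ift S\<close> it moves the other onto
    the truncated character, whose own transform is the averaging kernel.\<close>
  define S where "S w = ?K w * cnj (ift T w)" for w
  have Tm: "T \<in> borel_measurable \<mu>"
    using T by simp
  have S: "integrable \<mu> S"
    unfolding S_def[abs_def] using norm_ift_le[OF _ T] Tm
    by (intro integrable_indicator_bounded borel_measurable_cnj borel_measurable_ift) auto
  have iS: "ift S y = cnj (\<integral>x. of_real (real p powi n) * indicator (cyl p y n) x * T x \<partial>\<mu>)" if y: "y \<in> vil p" for y
  proof -
    let ?c = "\<lambda>w. ?K w * cnj (chi p y w)"
    have c: "integrable \<mu> ?c"
      using y by (intro integrable_indicator_bounded[where C = 1] borel_measurable_cnj measurable_chi_right) auto
    have "ift S y = cnj (\<integral>w. ?c w * ift T w \<partial>\<mu>)"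
      unfolding ift_def[of S] S_def
      by (subst Bochner_Integration.integral_cnj[symmetric])
        (auto intro!: Bochner_Integration.integral_cong simp: chi_commute[of p y] split: split_indicator)
    also have "(\<integral>w. ?c w * ift T w \<partial>\<mu>) = (\<integral>x. T x * ift ?c x \<partial>\<mu>)"
      by (rule ift_mult_formula[OF c T])
    also have "\<dots> = (\<integral>x. of_real (real p powi n) * indicator (cyl p y n) x * T x \<partial>\<mu>)"
    proof (rule Bochner_Integration.integral_cong[OF refl])
      fix x assume "x \<in> space \<mu>"
      then have "ift ?c x = of_real (real p powi n) * indicator (cyl p y n) x"
        using integral_vnbh_chi[of x y n] y
        by (simp add: ift_def chi_commute[of p _ x] mult_ac)
      then show "T x * ift ?c x = of_real (real p powi n) * indicator (cyl p y n) x * T x"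
        by (simp only: mult_ac)
    qed
    finally show ?thesis .
  qed
  have "(\<integral>w. ?K w * (ift T w * cnj (ift T w)) \<partial>\<mu>) = (\<integral>w. S w * ift T w \<partial>\<mu>)"
    by (simp add: S_def mult_ac)
  also have "\<dots> = (\<integral>y. T y * ift S y \<partial>\<mu>)"
    by (rule ift_mult_formula[OF S T])
  also have "\<dots> = cnj (\<integral>y. cnj (T y) * (\<integral>x. of_real (real p powi n) * indicator (cyl p y n) x * T x \<partial>\<mu>) \<partial>\<mu>)"
    by (subst Bochner_Integration.integral_cnj[symmetric], rule Bochner_Integration.integral_cong) (auto simp: iS)
  finally have "cnj (\<integral>w. ?K w * (ift T w * cnj (ift T w)) \<partial>\<mu>) =
      (\<integral>y. cnj (T y) * (\<integral>x. of_real (real p powi n) * indicator (cyl p y n) x * T x \<partial>\<mu>) \<partial>\<mu>)"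
    by simp
  moreover have "cnj (\<integral>w. ?K w * (ift T w * cnj (ift T w)) \<partial>\<mu>) = (\<integral>w. ?K w * (ift T w * cnj (ift T w)) \<partial>\<mu>)"
    by (subst Bochner_Integration.integral_cnj[symmetric], rule Bochner_Integration.integral_cong)
      (auto simp: mult_ac split: split_indicator)
  ultimately show ?thesis by simp
qed

lemma norm_integral_vnbh_ift_sq:
  assumes T: "integrable \<mu> T"
  shows "ennreal (cmod (\<integral>w. indicator (vnbh p (- n)) w * (ift T w * cnj (ift T w)) \<partial>\<mu>)) =
    sqn \<mu> (\<lambda>w. indicator (vnbh p (- n)) w * ift T w)"
proof -
  let ?g = "\<lambda>w. indicator (vnbh p (- n)) w * (cmod (ift T w))\<^sup>2 :: real"
  have Tm [measurable]: "T \<in> borel_measurable \<mu>" using T by simp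
  have g: "integrable \<mu> ?g"
  proof (rule Bochner_Integration.integrable_bound)
    show "integrable \<mu> (\<lambda>w. indicator (vnbh p (- n)) w * (\<integral>x. cmod (T x) \<partial>\<mu>)\<^sup>2 :: real)"
      by (intro integrable_mult_left integrable_real_indicator) simp_all
    show "?g \<in> borel_measurable \<mu>" by measurable
    show "AE w in \<mu>. norm (?g w) \<le> norm (indicator (vnbh p (- n)) w * (\<integral>x. cmod (T x) \<partial>\<mu>)\<^sup>2 :: real)"
      using norm_ift_le[OF _ T] by (intro AE_I2) (auto intro!: power_mono split: split_indicator)
  qed
  have "(\<integral>w. indicator (vnbh p (- n)) w * (ift T w * cnj (ift T w)) \<partial>\<mu>) = (\<integral>w. of_real (?g w) \<partial>\<mu>)"
    by (intro Bochner_Integration.integral_cong) (auto simp: complex_norm_square[symmetric] split: split_indicator)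
  then have "cmod (\<integral>w. indicator (vnbh p (- n)) w * (ift T w * cnj (ift T w)) \<partial>\<mu>) = \<bar>\<integral>w. ?g w \<partial>\<mu>\<bar>"
    by (simp only: integral_complex_of_real norm_of_real)
  also have "\<dots> = (\<integral>w. ?g w \<partial>\<mu>)"
    by (intro abs_of_nonneg Bochner_Integration.integral_nonneg) auto
  also have "ennreal \<dots> = (\<integral>\<^sup>+w. ennreal (?g w) \<partial>\<mu>)"
    by (rule nn_integral_eq_integral[symmetric, OF g]) auto
  also have "\<dots> = sqn \<mu> (\<lambda>w. indicator (vnbh p (- n)) w * ift T w)"
    unfolding sqn_def by (intro nn_integral_cong) (auto simp: norm_mult split: split_indicator)
  finally show ?thesis .
qed


lemma mem_cyl_commute: "x \<in> vil p \<Longrightarrow> y \<in> vil p \<Longrightarrow> x \<in> cyl p y n \<longleftrightarrow> y \<in> cyl p x n"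
  by (auto simp: cyl_def)

text \<open>Tonelli's theorem for the averaging kernel asks for joint measurability of the relation
  of sharing a coset, a countable conjunction of coordinate equations.\<close>

lemma measurable_cyl_rel [measurable]:
  "(\<lambda>z. indicator (cyl p (fst z) n) (snd z) :: ennreal) \<in> borel_measurable (\<mu> \<Otimes>\<^sub>M \<mu>)"
proof -
  have real: "(\<lambda>z. real (fst z j)) \<in> borel_measurable (\<mu> \<Otimes>\<^sub>M \<mu>)"
    "(\<lambda>z. real (snd z j)) \<in> borel_measurable (\<mu> \<Otimes>\<^sub>M \<mu>)" for j
    using measurable_compose[OF measurable_compose[OF measurable_fst measurable_coord], of real borel]
      measurable_compose[OF measurable_compose[OF measurable_snd measurable_coord], of real borel] by simp_all
  let ?A = "{z \<in> space (\<mu> \<Otimes>\<^sub>M \<mu>). \<forall>j\<in>{..n}. real (snd z j) = real (fst z j)}"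
  have "?A \<in> sets (\<mu> \<Otimes>\<^sub>M \<mu>)"
  proof (rule sets.sets_Collect_countable_Ball)
    show "{z \<in> space (\<mu> \<Otimes>\<^sub>M \<mu>). real (snd z j) = real (fst z j)} \<in> sets (\<mu> \<Otimes>\<^sub>M \<mu>)" for j
      by (rule borel_measurable_eq[OF real(2) real(1)])
  qed
  then have "(indicator ?A :: _ \<Rightarrow> ennreal) \<in> borel_measurable (\<mu> \<Otimes>\<^sub>M \<mu>)"
    by (rule borel_measurable_indicator)
  then show ?thesis
    by (rule measurable_cong[THEN iffD1, rotated])
      (auto simp: space_pair_measure cyl_def split: split_indicator)
qed

lemma integral_norm_bound_ennreal':
  fixes f :: "vseq \<Rightarrow> complex"
  shows "ennreal (cmod (\<integral>x. f x \<partial>\<mu>)) \<le> (\<integral>\<^sup>+x. ennreal (cmod (f x)) \<partial>\<mu>)"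
  by (cases "integrable \<mu> f") (simp_all add: integral_norm_bound_ennreal not_integrable_integral_eq)

lemma sqn_vnbh_LIMSEQ:
  assumes [measurable]: "f \<in> borel_measurable \<mu>"
  shows "(\<lambda>n. sqn \<mu> (\<lambda>x. indicator (vnbh p (- int n)) x * f x)) \<longlonglongrightarrow> sqn \<mu> f"
proof -
  let ?g = "\<lambda>n x. ennreal ((cmod (indicator (vnbh p (- int n)) x * f x))\<^sup>2)"
  have mono: "incseq ?g"
    by (intro monoI le_funI ennreal_leI power_mono)
      (auto simp: norm_mult vnbh_def split: split_indicator)
  have "(SUP n. ?g n x) = ennreal ((cmod (f x))\<^sup>2)" if "x \<in> vil p" for x
  proof (rule antisym)
    show "(SUP n. ?g n x) \<le> ennreal ((cmod (f x))\<^sup>2)"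
      by (intro SUP_least) (auto split: split_indicator)
    from that obtain n where "x \<in> vnbh p (- int n)"
      using vil_eq_UN by blast
    then show "ennreal ((cmod (f x))\<^sup>2) \<le> (SUP n. ?g n x)"
      by (intro SUP_upper2[of n]) auto
  qed
  then have "sqn \<mu> f = (\<integral>\<^sup>+x. (SUP n. ?g n x) \<partial>\<mu>)"
    unfolding sqn_def by (intro nn_integral_cong) simp
  also have "\<dots> = (SUP n. \<integral>\<^sup>+x. ?g n x \<partial>\<mu>)"
    by (rule nn_integral_monotone_convergence_SUP[OF mono]) measurable
  finally have "sqn \<mu> f = (SUP n. \<integral>\<^sup>+x. ?g n x \<partial>\<mu>)" .
  moreover have "incseq (\<lambda>n. \<integral>\<^sup>+x. ?g n x \<partial>\<mu>)"
    using mono by (intro monoI nn_integral_mono) (auto simp: incseq_def le_fun_def)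
  ultimately show ?thesis
    unfolding sqn_def by (simp add: LIMSEQ_SUP)
qed

lemma sqn_le_vnbh:
  assumes "f \<in> borel_measurable \<mu>"
    and "\<And>n. sqn \<mu> (\<lambda>x. indicator (vnbh p (- int n)) x * f x) \<le> C"
  shows "sqn \<mu> f \<le> C"
  using LIMSEQ_le_const2[OF sqn_vnbh_LIMSEQ[OF assms(1)]] assms(2) by blast

text \<open>The norm truncated to \<open>vnbh p (- n)\<close> is a quadratic form in the averaging
  kernel, which is symmetric and has mass 1 in each variable. Hence |T x| |T y| <= (|T x|^2 + |T
  y|^2) / 2 bounds the form by \<open>sqn \<mu> T\<close>, uniformly in \<open>n\<close>.\<close>

lemma Bessel_ift:
  assumes T: "integrable \<mu> T"
  shows "sqn \<mu> (ift T) \<le> sqn \<mu> T"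
proof (rule sqn_le_vnbh)
  have Tm [measurable]: "T \<in> borel_measurable \<mu>" using T by simp
  show "ift T \<in> borel_measurable \<mu>" by measurable
  fix n :: nat
  let ?c = "ennreal (real p powi int n)"
  let ?r = "\<lambda>y x. indicator (cyl p y (int n)) x :: ennreal"
  let ?t = "\<lambda>x. ennreal ((cmod (T x))\<^sup>2)"
  \<comment> \<open>The height p^n of the kernel cancels the measure p^(-n) of a coset.\<close>
  have half: "(\<integral>\<^sup>+y. \<integral>\<^sup>+x. ?c * ?r y x * ?t y \<partial>\<mu> \<partial>\<mu>) = sqn \<mu> T"
    unfolding sqn_def
  proof (rule nn_integral_cong)
    fix y assume y: "y \<in> space \<mu>"
    have "(\<integral>\<^sup>+x. ?c * ?r y x * ?t y \<partial>\<mu>) = (\<integral>\<^sup>+x. (?c * ?t y) * ?r y x \<partial>\<mu>)"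
      by (simp only: mult_ac)
    also have "\<dots> = (?c * ?t y) * emeasure \<mu> (cyl p y (int n))"
      by (rule nn_integral_cmult_indicator) simp
    also have "\<dots> = ?t y * (ennreal (real p powi - int n) * ?c)"
      using y by (simp add: emeasure_cyl mult_ac)
    finally show "(\<integral>\<^sup>+x. ?c * ?r y x * ?t y \<partial>\<mu>) = ?t y"
      by (simp only: powi_minus mult_1_right)
  qed
  \<comment> \<open>Sharing a coset is a symmetric relation, so Tonelli exchanges the roles of
    \<open>x\<close> and \<open>y\<close>.\<close>
  have swap: "(\<integral>\<^sup>+y. \<integral>\<^sup>+x. ?c * ?r y x * ?t x \<partial>\<mu> \<partial>\<mu>) = (\<integral>\<^sup>+y. \<integral>\<^sup>+x. ?c * ?r y x * ?t y \<partial>\<mu> \<partial>\<mu>)"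
  proof -
    have "(\<lambda>z. ?c * ?r (fst z) (snd z) * ?t (snd z)) \<in> borel_measurable (\<mu> \<Otimes>\<^sub>M \<mu>)"
      by measurable
    then have "(\<integral>\<^sup>+y. \<integral>\<^sup>+x. ?c * ?r y x * ?t x \<partial>\<mu> \<partial>\<mu>) = (\<integral>\<^sup>+x. \<integral>\<^sup>+y. ?c * ?r y x * ?t x \<partial>\<mu> \<partial>\<mu>)"
      using pair.Fubini'[of "\<lambda>y x. ?c * ?r y x * ?t x"] by (simp add: case_prod_beta')
    also have "\<dots> = (\<integral>\<^sup>+x. \<integral>\<^sup>+y. ?c * ?r x y * ?t x \<partial>\<mu> \<partial>\<mu>)"
      by (intro nn_integral_cong) (auto simp: mem_cyl_commute split: split_indicator)
    finally show ?thesis .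
  qed
  have "sqn \<mu> (\<lambda>w. indicator (vnbh p (- int n)) w * ift T w) =
      ennreal (cmod (\<integral>y. cnj (T y) * (\<integral>x. of_real (real p powi int n) * indicator (cyl p y (int n)) x * T x \<partial>\<mu>) \<partial>\<mu>))"
    by (simp only: norm_integral_vnbh_ift_sq[OF T, symmetric] integral_vnbh_ift_sq[OF T])
  also have "\<dots> \<le> (\<integral>\<^sup>+y. ennreal (cmod (cnj (T y) * (\<integral>x. of_real (real p powi int n) * indicator (cyl p y (int n)) x * T x \<partial>\<mu>))) \<partial>\<mu>)"
    by (rule integral_norm_bound_ennreal') 
  also have "\<dots> \<le> (\<integral>\<^sup>+y. \<integral>\<^sup>+x. (?c * ?r y x * ?t x + ?c * ?r y x * ?t y) / 2 \<partial>\<mu> \<partial>\<mu>)"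
  proof (rule nn_integral_mono)
    fix y assume y: "y \<in> space \<mu>"
    have "ennreal (cmod (cnj (T y) * (\<integral>x. of_real (real p powi int n) * indicator (cyl p y (int n)) x * T x \<partial>\<mu>)))
        = ennreal (cmod (\<integral>x. cnj (T y) * (of_real (real p powi int n) * indicator (cyl p y (int n)) x * T x) \<partial>\<mu>))"
      by (subst integral_mult_right_zero) simp
    also have "\<dots> \<le> (\<integral>\<^sup>+x. ennreal (cmod (cnj (T y) * (of_real (real p powi int n) * indicator (cyl p y (int n)) x * T x))) \<partial>\<mu>)"
      by (rule integral_norm_bound_ennreal')
    also have "\<dots> \<le> (\<integral>\<^sup>+x. (?c * ?r y x * ?t x + ?c * ?r y x * ?t y) / 2 \<partial>\<mu>)"
    proof (rule nn_integral_mono)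
      fix x
      have "cmod (T x) * cmod (T y) \<le> ((cmod (T x))\<^sup>2 + (cmod (T y))\<^sup>2) / 2"
        using sum_squares_bound[of "cmod (T x)" "cmod (T y)"] by simp
      then have "real p powi int n * (cmod (T x) * cmod (T y)) \<le> real p powi int n * (((cmod (T x))\<^sup>2 + (cmod (T y))\<^sup>2) / 2)"
        by (intro mult_left_mono) auto
      then have "ennreal (real p powi int n * (cmod (T x) * cmod (T y)))
          \<le> ennreal (real p powi int n * (((cmod (T x))\<^sup>2 + (cmod (T y))\<^sup>2) / 2))"
        by (rule ennreal_leI)
      also have "\<dots> = (?c * ?t x + ?c * ?t y) / 2"
        by (simp add: ennreal_mult[symmetric] ennreal_plus[symmetric] ennreal_numeral[symmetric] divide_ennreal
            ring_distribs del: ennreal_plus ennreal_numeral)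
      finally show "ennreal (cmod (cnj (T y) * (of_real (real p powi int n) * indicator (cyl p y (int n)) x * T x)))
          \<le> (?c * ?r y x * ?t x + ?c * ?r y x * ?t y) / 2"
        by (auto simp: norm_mult norm_power mult_ac split: split_indicator)
    qed
    finally show "ennreal (cmod (cnj (T y) * (\<integral>x. of_real (real p powi int n) * indicator (cyl p y (int n)) x * T x \<partial>\<mu>)))
      \<le> (\<integral>\<^sup>+x. (?c * ?r y x * ?t x + ?c * ?r y x * ?t y) / 2 \<partial>\<mu>)" .
  qed
  also have "\<dots> = (\<integral>\<^sup>+y. ((\<integral>\<^sup>+x. ?c * ?r y x * ?t x \<partial>\<mu>) + (\<integral>\<^sup>+x. ?c * ?r y x * ?t y \<partial>\<mu>)) / 2 \<partial>\<mu>)"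
    by (intro nn_integral_cong) (simp add: nn_integral_divide nn_integral_add)
  also have "\<dots> = ((\<integral>\<^sup>+y. \<integral>\<^sup>+x. ?c * ?r y x * ?t x \<partial>\<mu> \<partial>\<mu>) + (\<integral>\<^sup>+y. \<integral>\<^sup>+x. ?c * ?r y x * ?t y \<partial>\<mu> \<partial>\<mu>)) / 2"
  proof -
    have 1: "(\<lambda>y. \<integral>\<^sup>+x. ?c * ?r y x * ?t x \<partial>\<mu>) \<in> borel_measurable \<mu>"
      "(\<lambda>y. \<integral>\<^sup>+x. ?c * ?r y x * ?t y \<partial>\<mu>) \<in> borel_measurable \<mu>"
      by (intro borel_measurable_nn_integral; simp add: case_prod_beta'; measurable)+
    then show ?thesis
      by (subst nn_integral_divide) (auto simp: nn_integral_add)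
  qed
  also have "\<dots> = (sqn \<mu> T + sqn \<mu> T) / 2"
    by (simp only: swap half)
  also have "\<dots> = sqn \<mu> T"
    by (simp only: mult_2[symmetric] mult.commute[of 2]) (simp add: mult_divide_eq_ennreal)
  finally show "sqn \<mu> (\<lambda>w. indicator (vnbh p (- int n)) w * ift T w) \<le> sqn \<mu> T" .
qed

text \<open>The averaging kernel reproduces a function that is constant on the cosets of
  \<open>vnbh p n\<close>, so the part of the transform on \<open>vnbh p (- n)\<close> already
  carries the whole norm.\<close>

lemma Plancherel_invariant:
  assumes T: "integrable \<mu> T" "T \<in> L2 \<mu>"
    and inv: "\<And>x y. y \<in> vil p \<Longrightarrow> x \<in> cyl p y n \<Longrightarrow> T x = T y"
  shows "sqn \<mu> T \<le> sqn \<mu> (ift T)"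
proof -
  have E: "(\<integral>x. of_real (real p powi n) * indicator (cyl p y n) x * T x \<partial>\<mu>) = T y" if y: "y \<in> vil p" for y
  proof -
    have "(\<integral>x. of_real (real p powi n) * indicator (cyl p y n) x * T x \<partial>\<mu>) =
        (\<integral>x. indicator (cyl p y n) x *\<^sub>R (of_real (real p powi n) * T y) \<partial>\<mu>)"
      using inv[OF y] by (intro Bochner_Integration.integral_cong) (auto split: split_indicator)
    also have "\<dots> = measure \<mu> (cyl p y n) *\<^sub>R (of_real (real p powi n) * T y)"
      using cyl_subset[of p y n] by (simp add: Int_absorb2 Int_absorb1 emeasure_cyl y)
    also have "measure \<mu> (cyl p y n) = real p powi (- n)"
      by (simp add: measure_def emeasure_cyl y)
    finally show ?thesis
      by (simp add: power_int_minus scaleR_conv_of_real)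
  qed
  have "(\<integral>y. cnj (T y) * (\<integral>x. of_real (real p powi n) * indicator (cyl p y n) x * T x \<partial>\<mu>) \<partial>\<mu>) =
      (\<integral>y. of_real ((cmod (T y))\<^sup>2) \<partial>\<mu>)"
  proof (rule Bochner_Integration.integral_cong)
    fix y assume "y \<in> space \<mu>"
    then show "cnj (T y) * (\<integral>x. of_real (real p powi n) * indicator (cyl p y n) x * T x \<partial>\<mu>) =
        of_real ((cmod (T y))\<^sup>2)"
      by (simp only: E space_mu complex_norm_square mult.commute[of "T y"])
  qed simp
  also have "\<dots> = of_real (\<integral>y. (cmod (T y))\<^sup>2 \<partial>\<mu>)"
    by (rule integral_complex_of_real)
  finally have "sqn \<mu> (\<lambda>w. indicator (vnbh p (- n)) w * ift T w) = sqn \<mu> T"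
    unfolding norm_integral_vnbh_ift_sq[OF T(1), symmetric] integral_vnbh_ift_sq[OF T(1)]
    by (simp add: sqn_integral[OF T(2), symmetric])
  moreover have "sqn \<mu> (\<lambda>w. indicator (vnbh p (- n)) w * ift T w) \<le> sqn \<mu> (ift T)"
    by (rule sqn_mono) (auto simp: norm_mult split: split_indicator)
  ultimately show ?thesis by simp
qed


section \<open>Extension of the transform to square integrable functions\<close>

definition vtrunc :: "(vseq \<Rightarrow> complex) \<Rightarrow> nat \<Rightarrow> vseq \<Rightarrow> complex" where
  "vtrunc f n x = indicator (vnbh p (- int n)) x * f x"

lemma vtrunc_L2: "f \<in> L2 \<mu> \<Longrightarrow> vtrunc f n \<in> L2 \<mu>"
  unfolding vtrunc_def[abs_def] by (rule L2_indicator) simp_all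

lemma vtrunc_integrable: "f \<in> L2 \<mu> \<Longrightarrow> integrable \<mu> (vtrunc f n)"
  unfolding vtrunc_def[abs_def] by (rule integrable_indicator_L2) simp_all

lemma vtrunc_tendsto:
  assumes f: "f \<in> L2 \<mu>"
  shows "L2_tendsto \<mu> (vtrunc f) f"
proof -
  have [measurable]: "f \<in> borel_measurable \<mu>" "vtrunc f n \<in> borel_measurable \<mu>" for n
    using f vtrunc_L2[OF f] by (auto simp: L2_iff)
  have "(\<lambda>n. \<integral>\<^sup>+x. ennreal ((cmod (vtrunc f n x - f x))\<^sup>2) \<partial>\<mu>) \<longlonglongrightarrow> (\<integral>\<^sup>+x. 0 \<partial>\<mu>)"
  proof (rule nn_integral_dominated_convergence[where w = "\<lambda>x. ennreal ((cmod (f x))\<^sup>2)"])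
    show "(\<integral>\<^sup>+x. ennreal ((cmod (f x))\<^sup>2) \<partial>\<mu>) < \<infinity>"
      using f by (simp add: L2_iff sqn_def)
    show "AE x in \<mu>. ennreal ((cmod (vtrunc f j x - f x))\<^sup>2) \<le> ennreal ((cmod (f x))\<^sup>2)" for j
      by (auto simp: vtrunc_def split: split_indicator)
    show "AE x in \<mu>. (\<lambda>n. ennreal ((cmod (vtrunc f n x - f x))\<^sup>2)) \<longlonglongrightarrow> 0"
    proof (rule AE_I2)
      fix x assume "x \<in> space \<mu>"
      then obtain N where N: "x \<in> vnbh p (- int N)" using vil_eq_UN by auto
      have "ennreal ((cmod (vtrunc f n x - f x))\<^sup>2) = 0" if "N \<le> n" for n
      proof -
        have "x \<in> vnbh p (- int n)" using N that by (auto simp: vnbh_def)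
        then show ?thesis by (simp add: vtrunc_def)
      qed
      then show "(\<lambda>n. ennreal ((cmod (vtrunc f n x - f x))\<^sup>2)) \<longlonglongrightarrow> 0"
        by (intro tendsto_eventually eventually_sequentiallyI[of N])
    qed
  qed measurable
  then show ?thesis by (simp add: L2_tendsto_def)
qed

lemma Bessel_fourier_L1:
  assumes "integrable \<mu> T"
  shows "sqn \<mu> (fourier_L1 p \<mu> T) \<le> sqn \<mu> T"
proof -
  have "integrable \<mu> (\<lambda>x. cnj (T x))" using assms by simp
  from Bessel_ift[OF this] show ?thesis by (simp add: fourier_L1_eq[abs_def])
qed

lemma fourier_L1_L2: "integrable \<mu> T \<Longrightarrow> T \<in> L2 \<mu> \<Longrightarrow> fourier_L1 p \<mu> T \<in> L2 \<mu>"
  using Bessel_fourier_L1[of T] by (auto simp: L2_iff borel_measurable_fourier_L1)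

lemma fourier_L1_diff:
  assumes "integrable \<mu> S" "integrable \<mu> T" "w \<in> vil p"
  shows "fourier_L1 p \<mu> (\<lambda>x. S x - T x) w = fourier_L1 p \<mu> S w - fourier_L1 p \<mu> T w"
proof -
  have "integrable \<mu> (\<lambda>x. U x * cnj (chi p x w))" if "integrable \<mu> U" for U
    using that assms(3)
    by (intro integrable_mult_unit borel_measurable_cnj) (simp_all add: chi_commute[of p _ w] measurable_chi_right)
  then show ?thesis
    using assms by (simp add: fourier_L1_def left_diff_distrib)
qed

lemma Bessel_fourier_L1_diff:
  assumes "integrable \<mu> S" "integrable \<mu> T"
  shows "sqn \<mu> (\<lambda>w. fourier_L1 p \<mu> S w - fourier_L1 p \<mu> T w) \<le> sqn \<mu> (\<lambda>x. S x - T x)"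
proof -
  have "sqn \<mu> (\<lambda>w. fourier_L1 p \<mu> S w - fourier_L1 p \<mu> T w) = sqn \<mu> (fourier_L1 p \<mu> (\<lambda>x. S x - T x))"
    unfolding sqn_def by (intro nn_integral_cong) (simp add: fourier_L1_diff[OF assms])
  also have "\<dots> \<le> sqn \<mu> (\<lambda>x. S x - T x)"
    using assms by (intro Bessel_fourier_L1) simp
  finally show ?thesis .
qed

text \<open>The existence behind the choice in \<open>fourier\<close>: truncations are Cauchy in
  norm, Bessel's inequality passes this on to their transforms, and completeness supplies the
  limit.\<close>

lemma fourier_exists:
  assumes f: "f \<in> L2 \<mu>"
  shows "\<exists>F. F \<in> L2 \<mu> \<and> (\<exists>g. (\<forall>n. g n \<in> L2 \<mu> \<and> integrable \<mu> (g n)) \<and>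
    L2_tendsto \<mu> g f \<and> L2_tendsto \<mu> (\<lambda>n. fourier_L1 p \<mu> (g n)) F)"
proof -
  note g = vtrunc_L2[OF f] vtrunc_integrable[OF f]
  have "\<exists>N. \<forall>m\<ge>N. \<forall>n\<ge>N. sqn \<mu> (\<lambda>w. fourier_L1 p \<mu> (vtrunc f m) w - fourier_L1 p \<mu> (vtrunc f n) w) \<le> ennreal e"
    if e: "0 < e" for e
  proof -
    have "\<forall>\<^sub>F n in sequentially. sqn \<mu> (\<lambda>x. vtrunc f n x - f x) < ennreal (e / 4)"
      by (rule order_tendstoD(2)[OF vtrunc_tendsto[OF f, unfolded L2_tendsto_iff]]) (use e in simp)
    \<comment> \<open>The quarter compensates for \<open>sqn_triangle\<close>: two errors, each
      doubled, add up to \<open>e\<close>.\<close>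
    then obtain N where N: "sqn \<mu> (\<lambda>x. vtrunc f n x - f x) < ennreal (e / 4)" if "N \<le> n" for n
      unfolding eventually_sequentially by blast
    show ?thesis
    proof (intro exI allI impI)
      fix m n assume mn: "N \<le> m" "N \<le> n"
      have "sqn \<mu> (\<lambda>w. fourier_L1 p \<mu> (vtrunc f m) w - fourier_L1 p \<mu> (vtrunc f n) w)
          \<le> sqn \<mu> (\<lambda>x. vtrunc f m x - vtrunc f n x)"
        by (rule Bessel_fourier_L1_diff[OF g(2) g(2)])
      also have "\<dots> \<le> 2 * sqn \<mu> (\<lambda>x. vtrunc f m x - f x) + 2 * sqn \<mu> (\<lambda>x. f x - vtrunc f n x)"
        using f g(1) by (intro sqn_triangle) (auto simp: L2_iff)
      also have "\<dots> \<le> 2 * ennreal (e / 4) + 2 * ennreal (e / 4)"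
        using N[OF mn(1)] N[OF mn(2)] unfolding sqn_minus_commute[of \<mu> f]
        by (intro add_mono mult_left_mono) simp_all
      also have "\<dots> = ennreal (2 * (e / 4) + 2 * (e / 4))"
        using e by (simp only: ennreal_plus ennreal_mult ennreal_numeral divide_nonneg_nonneg mult_nonneg_nonneg
            less_imp_le zero_le_numeral)
      also have "2 * (e / 4) + 2 * (e / 4) = e" by simp
      finally show "sqn \<mu> (\<lambda>w. fourier_L1 p \<mu> (vtrunc f m) w - fourier_L1 p \<mu> (vtrunc f n) w) \<le> ennreal e" .
    qed
  qed
  note cauchy = this
  obtain F where "F \<in> L2 \<mu>" "L2_tendsto \<mu> (\<lambda>n. fourier_L1 p \<mu> (vtrunc f n)) F"
    by (rule L2_complete[OF fourier_L1_L2[OF g(2) g(1)] cauchy])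
  with g vtrunc_tendsto[OF f] show ?thesis by blast
qed

lemma fourier_spec:
  assumes f: "f \<in> L2 \<mu>"
  obtains g where "fourier p \<mu> f \<in> L2 \<mu>" "\<And>n. g n \<in> L2 \<mu>" "\<And>n. integrable \<mu> (g n)"
    "L2_tendsto \<mu> g f" "L2_tendsto \<mu> (\<lambda>n. fourier_L1 p \<mu> (g n)) (fourier p \<mu> f)"
  using someI_ex[OF fourier_exists[OF f]] unfolding fourier_def[symmetric] by blast

lemma fourier_L2: "f \<in> L2 \<mu> \<Longrightarrow> fourier p \<mu> f \<in> L2 \<mu>"
  by (erule fourier_spec)

lemma ift_L2: "integrable \<mu> T \<Longrightarrow> T \<in> L2 \<mu> \<Longrightarrow> ift T \<in> L2 \<mu>"
  using Bessel_ift[of T] by (auto simp: L2_iff)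

text \<open>The multiplication formula gives the identity for the approximating integrable
  functions, and both sides pass to the limit by continuity of the inner product.\<close>

lemma Parseval:
  assumes T: "integrable \<mu> T" "T \<in> L2 \<mu>" and f: "f \<in> L2 \<mu>"
  shows "(\<integral>x. ift T x * cnj (f x) \<partial>\<mu>) = (\<integral>w. T w * cnj (fourier p \<mu> f w) \<partial>\<mu>)"
proof -
  obtain g where g: "fourier p \<mu> f \<in> L2 \<mu>" "\<And>n. g n \<in> L2 \<mu>" "\<And>n. integrable \<mu> (g n)"
    "L2_tendsto \<mu> g f" "L2_tendsto \<mu> (\<lambda>n. fourier_L1 p \<mu> (g n)) (fourier p \<mu> f)"
    using fourier_spec[OF f] by blast
  have "(\<integral>x. ift T x * cnj (g n x) \<partial>\<mu>) = (\<integral>w. T w * cnj (fourier_L1 p \<mu> (g n) w) \<partial>\<mu>)" for n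
  proof -
    have "(\<integral>x. cnj (g n x) * ift T x \<partial>\<mu>) = (\<integral>w. T w * ift (\<lambda>x. cnj (g n x)) w \<partial>\<mu>)"
      using g(3) by (intro ift_mult_formula T) simp
    then show ?thesis
      by (simp add: fourier_L1_eq mult.commute)
  qed
  moreover have "(\<lambda>n. \<integral>x. ift T x * cnj (g n x) \<partial>\<mu>) \<longlonglongrightarrow> (\<integral>x. ift T x * cnj (f x) \<partial>\<mu>)"
    by (rule L2_tendsto_inner[OF ift_L2[OF T] g(2) f g(4)])
  moreover have "(\<lambda>n. \<integral>w. T w * cnj (fourier_L1 p \<mu> (g n) w) \<partial>\<mu>) \<longlonglongrightarrow> (\<integral>w. T w * cnj (fourier p \<mu> f w) \<partial>\<mu>)"
    by (rule L2_tendsto_inner[OF T(2) fourier_L1_L2[OF g(3) g(2)] g(1) g(5)])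
  ultimately show ?thesis
    by (simp add: LIMSEQ_unique)
qed

lemma fourier_L1_vtrunc_invariant:
  assumes "x \<in> cyl p y (int n)"
  shows "fourier_L1 p \<mu> (vtrunc f n) x = fourier_L1 p \<mu> (vtrunc f n) y"
proof -
  have "chi p z x = chi p z y" if "z \<in> vnbh p (- int n)" for z
    using chi_cong[of "int n" x y z p p] assms that by (simp add: cyl_def chi_commute[of p z])
  then show ?thesis
    unfolding fourier_L1_def
    by (intro Bochner_Integration.integral_cong) (auto simp: vtrunc_def split: split_indicator)
qed

text \<open>The choice in \<open>fourier\<close> comes with an unspecified approximating sequence.
  Bessel's inequality allows it to be exchanged for the truncations, whose transforms are locally
  constant.\<close>

lemma fourier_vtrunc_tendsto:
  assumes f: "f \<in> L2 \<mu>"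
  shows "L2_tendsto \<mu> (\<lambda>n. fourier_L1 p \<mu> (vtrunc f n)) (fourier p \<mu> f)"
proof -
  obtain g where g: "fourier p \<mu> f \<in> L2 \<mu>" "\<And>n. g n \<in> L2 \<mu>" "\<And>n. integrable \<mu> (g n)"
    "L2_tendsto \<mu> g f" "L2_tendsto \<mu> (\<lambda>n. fourier_L1 p \<mu> (g n)) (fourier p \<mu> f)"
    using fourier_spec[OF f] by blast
  let ?a = "\<lambda>n. sqn \<mu> (\<lambda>x. vtrunc f n x - f x)"
  let ?b = "\<lambda>n. sqn \<mu> (\<lambda>x. g n x - f x)"
  let ?c = "\<lambda>n. sqn \<mu> (\<lambda>w. fourier_L1 p \<mu> (g n) w - fourier p \<mu> f w)"
  let ?s = "\<lambda>n. sqn \<mu> (\<lambda>w. fourier_L1 p \<mu> (vtrunc f n) w - fourier p \<mu> f w)"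
  have m: "f \<in> borel_measurable \<mu>" "g n \<in> borel_measurable \<mu>" "vtrunc f n \<in> borel_measurable \<mu>"
    "fourier p \<mu> f \<in> borel_measurable \<mu>" for n
    using f g vtrunc_L2[OF f] by (auto simp: L2_iff)
  have le: "?s n \<le> 2 * (2 * ?a n + 2 * ?b n) + 2 * ?c n" for n
  proof -
    have "?s n \<le> 2 * sqn \<mu> (\<lambda>w. fourier_L1 p \<mu> (vtrunc f n) w - fourier_L1 p \<mu> (g n) w) + 2 * ?c n"
      by (intro sqn_triangle borel_measurable_fourier_L1 m)
    also have "\<dots> \<le> 2 * sqn \<mu> (\<lambda>x. vtrunc f n x - g n x) + 2 * ?c n"
      by (intro add_mono mult_left_mono Bessel_fourier_L1_diff vtrunc_integrable f g(3)) simp_all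
    also have "\<dots> \<le> 2 * (2 * ?a n + 2 * ?b n) + 2 * ?c n"
      using sqn_triangle[OF m(3)[of n] m(1) m(2)[of n]] unfolding sqn_minus_commute[of \<mu> f]
      by (intro add_mono mult_left_mono) simp_all
    finally show ?thesis .
  qed
  have "(\<lambda>n. 2 * (2 * ?a n + 2 * ?b n) + 2 * ?c n) \<longlonglongrightarrow> 2 * (2 * 0 + 2 * 0) + 2 * 0"
    using vtrunc_tendsto[OF f] g(4,5) unfolding L2_tendsto_iff
    by (intro tendsto_add ennreal_tendsto_cmult) simp_all
  then have lim: "(\<lambda>n. 2 * (2 * ?a n + 2 * ?b n) + 2 * ?c n) \<longlonglongrightarrow> 0" by simp
  show ?thesis
    unfolding L2_tendsto_iff
    by (rule tendsto_sandwich[OF _ always_eventually[OF allI[OF le]] tendsto_const lim]) simp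
qed

text \<open>Enough of Plancherel's lower bound for the finiteness argument below; the transform is an
  \<open>L\<^sup>2\<close> limit of locally constant functions, for which the bound holds without the factor.\<close>

lemma Plancherel_lower_fourier:
  fixes k :: int
  assumes f: "f \<in> L2 \<mu>" and e: "e \<in> vil p"
  defines "T \<equiv> \<lambda>w. indicator (cyl p e k) w * cnj (fourier p \<mu> f w)"
  shows "sqn \<mu> T \<le> 4 * sqn \<mu> (ift T)"
proof -
  define h where "h n w = indicator (cyl p e k) w * cnj (fourier_L1 p \<mu> (vtrunc f n) w)" for n w
  have fin: "emeasure \<mu> (cyl p e k) < \<infinity>"
    by (simp add: emeasure_cyl e)
  have T: "T \<in> L2 \<mu>" "integrable \<mu> T"
    unfolding T_def by (intro L2_indicator integrable_indicator_L2 L2_cnj fourier_L2 f fin sets_cyl)+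
  have h: "h n \<in> L2 \<mu>" "integrable \<mu> (h n)" for n
    unfolding h_def[abs_def]
    by (intro L2_indicator integrable_indicator_L2 L2_cnj fourier_L1_L2 vtrunc_L2 vtrunc_integrable f fin sets_cyl)+
  let ?d = "\<lambda>n. sqn \<mu> (\<lambda>w. h n w - T w)"
  have d0: "?d \<longlonglongrightarrow> 0"
  proof (rule tendsto_sandwich[OF _ _ tendsto_const])
    show "(\<lambda>n. sqn \<mu> (\<lambda>w. fourier_L1 p \<mu> (vtrunc f n) w - fourier p \<mu> f w)) \<longlonglongrightarrow> 0"
      using fourier_vtrunc_tendsto[OF f] by (simp add: L2_tendsto_iff)
    have "?d n \<le> sqn \<mu> (\<lambda>w. fourier_L1 p \<mu> (vtrunc f n) w - fourier p \<mu> f w)" for n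
      by (rule sqn_mono)
        (auto simp: h_def T_def norm_mult complex_cnj_diff[symmetric] simp del: complex_cnj_diff split: split_indicator)
    then show "\<forall>\<^sub>F n in sequentially. ?d n \<le> sqn \<mu> (\<lambda>w. fourier_L1 p \<mu> (vtrunc f n) w - fourier p \<mu> f w)"
      by simp
  qed simp
  \<comment> \<open>Passing between \<open>T\<close> and \<open>h n\<close> costs a factor 2 before
    the transform and another after it; the remaining errors are multiples of \<open>?d n\<close>
    and vanish in the limit, leaving 4.\<close>
  have le: "sqn \<mu> T \<le> 2 * (2 * ?d n + 2 * sqn \<mu> (ift T)) + 2 * ?d n" for n
  proof -
    have hT: "integrable \<mu> (\<lambda>w. h n w - T w)"
      using h T by simp
    have "sqn \<mu> (h n) \<le> sqn \<mu> (ift (h n))"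
    proof (rule Plancherel_invariant[OF h(2) h(1)])
      \<comment> \<open>At level \<open>max (int n) k\<close> both the transform of the truncation
        and the indicator of the coset are constant.\<close>
      fix x y assume xy: "y \<in> vil p" "x \<in> cyl p y (max (int n) k)"
      then have "x \<in> cyl p y (int n)" "x \<in> cyl p e k \<longleftrightarrow> y \<in> cyl p e k"
        by (auto simp: cyl_def)
      then show "h n x = h n y"
        using fourier_L1_vtrunc_invariant[of x y n f] by (simp add: h_def indicator_def)
    qed
    also have "sqn \<mu> (ift (h n)) = sqn \<mu> (\<lambda>w. ift (\<lambda>w. h n w - T w) w + ift T w)"
      unfolding sqn_def
    proof (rule nn_integral_cong)
      fix w assume "w \<in> space \<mu>"
      then have "ift (\<lambda>w. h n w - T w) w + ift T w = ift (h n) w"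
        using integrable_mult_chi[OF h(2)[of n], of w] integrable_mult_chi[OF T(2), of w]
        by (simp add: ift_def left_diff_distrib)
      then show "ennreal ((cmod (ift (h n) w))\<^sup>2) = ennreal ((cmod (ift (\<lambda>w. h n w - T w) w + ift T w))\<^sup>2)"
        by simp
    qed
    also have "\<dots> \<le> 2 * sqn \<mu> (ift (\<lambda>w. h n w - T w)) + 2 * sqn \<mu> (ift T)"
      using hT T by (intro sqn_add_le borel_measurable_ift) auto
    also have "\<dots> \<le> 2 * ?d n + 2 * sqn \<mu> (ift T)"
      by (intro add_mono mult_left_mono Bessel_ift hT) simp_all
    finally have hn: "sqn \<mu> (h n) \<le> 2 * ?d n + 2 * sqn \<mu> (ift T)" .
    have "sqn \<mu> T = sqn \<mu> (\<lambda>w. h n w + (T w - h n w))" by simp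
    also have "\<dots> \<le> 2 * sqn \<mu> (h n) + 2 * sqn \<mu> (\<lambda>w. T w - h n w)"
      by (intro sqn_add_le borel_measurable_diff L2D h(1) T(1))
    also have "\<dots> \<le> 2 * (2 * ?d n + 2 * sqn \<mu> (ift T)) + 2 * ?d n"
      unfolding sqn_minus_commute[of \<mu> T] by (intro add_mono mult_left_mono hn) simp_all
    finally show ?thesis .
  qed
  have "(\<lambda>n. 2 * (2 * ?d n + 2 * sqn \<mu> (ift T)) + 2 * ?d n) \<longlonglongrightarrow> 2 * (2 * 0 + 2 * sqn \<mu> (ift T)) + 2 * 0"
    using d0 by (intro tendsto_add ennreal_tendsto_cmult tendsto_const) simp_all
  then have "sqn \<mu> T \<le> 2 * (2 * 0 + 2 * sqn \<mu> (ift T)) + 2 * 0"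
    by (rule LIMSEQ_le_const) (use le in blast)
  also have "\<dots> = 4 * sqn \<mu> (ift T)"
    by (simp add: mult.assoc[symmetric])
  finally show ?thesis .
qed


section \<open>Dilations, translations and frame coefficients\<close>

lemma sqn_dil:
  assumes "T \<in> borel_measurable \<mu>"
  shows "sqn \<mu> (\<lambda>w. T (dil k w)) = ennreal (real p powi (- k)) * sqn \<mu> T"
  unfolding sqn_def by (rule nn_integral_dil) (use assms in measurable)

lemma L2_dil: "T \<in> L2 \<mu> \<Longrightarrow> (\<lambda>w. T (dil k w)) \<in> L2 \<mu>"
  using measurable_compose[OF measurable_dil, of T borel k]
  by (auto simp: L2_iff sqn_dil ennreal_mult_less_top)

lemma integrable_dil:
  fixes T :: "vseq \<Rightarrow> complex"
  assumes "integrable \<mu> T"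
  shows "integrable \<mu> (\<lambda>w. T (dil k w))"
proof (rule integrableI_bounded)
  have m: "T \<in> borel_measurable \<mu>" using assms by simp
  show "(\<lambda>w. T (dil k w)) \<in> borel_measurable \<mu>"
    by (rule measurable_compose[OF measurable_dil m])
  have "(\<integral>\<^sup>+w. ennreal (norm (T (dil k w))) \<partial>\<mu>) = ennreal (real p powi (- k)) * (\<integral>\<^sup>+w. ennreal (norm (T w)) \<partial>\<mu>)"
    by (rule nn_integral_dil) (use m in measurable)
  also have "\<dots> < \<infinity>"
    using assms by (simp add: integrable_iff_bounded ennreal_mult_less_top)
  finally show "(\<integral>\<^sup>+w. ennreal (norm (T (dil k w))) \<partial>\<mu>) < \<infinity>" .
qed

lemma ift_dil_vadd:
  assumes T: "integrable \<mu> T" and h: "h \<in> vil p" and y: "y \<in> vil p"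
  shows "ift T (dil (- j) (vadd p h y)) =
    real p powi j *\<^sub>R ift (\<lambda>w. T (dil j w) * chi p w h) y"
proof -
  have m: "T \<in> borel_measurable \<mu>" using T by simp
  have "ift T (dil (- j) (vadd p h y)) = (\<integral>w. T (dil j (dil (- j) w)) * chi p (dil (- j) w) (vadd p h y) \<partial>\<mu>)"
    unfolding ift_def by (simp add: chi_dil dil_dil)
  also have "\<dots> = real p powi (- (- j)) *\<^sub>R (\<integral>w. T (dil j w) * chi p w (vadd p h y) \<partial>\<mu>)"
    by (rule integral_dil)
      (intro borel_measurable_times measurable_compose[OF measurable_dil m] measurable_chi measurable_ident_sets
        measurable_const; simp add: h y)
  also have "(\<integral>w. T (dil j w) * chi p w (vadd p h y) \<partial>\<mu>) = ift (\<lambda>w. T (dil j w) * chi p w h) y"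
    unfolding ift_def by (rule Bochner_Integration.integral_cong) (simp_all add: chi_vadd h y)
  finally show ?thesis by simp
qed

text \<open>Dilation and translation are moved from the affine function onto the test function,
  where they become a dilation of \<open>T\<close> and a character. The Jacobians p^(-j) and p^j
  cancel, so only the normalising factor \<open>c\<close> survives.\<close>

lemma frame_coefficient:
  assumes T: "integrable \<mu> T" "T \<in> L2 \<mu>" and f: "f \<in> L2 \<mu>" and h: "h \<in> vil p"
  shows "(\<integral>x. ift T x * cnj (of_real c * f (vsub p (dil j x) h)) \<partial>\<mu>) =
    of_real c * (\<integral>w. T (dil j w) * chi p w h * cnj (fourier p \<mu> f w) \<partial>\<mu>)"
proof -
  define T' where "T' w = T (dil j w) * chi p w h" for w
  have m [measurable]: "T \<in> borel_measurable \<mu>" "f \<in> borel_measurable \<mu>"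
    using T(1) f by (auto simp: L2_iff)
  have ch: "(\<lambda>w. chi p w h) \<in> borel_measurable \<mu>"
    using h by (simp add: chi_commute[of p _ h] measurable_chi_right)
  have T'1: "integrable \<mu> T'"
    unfolding T'_def[abs_def] by (rule integrable_mult_unit[OF integrable_dil[OF T(1)] ch]) simp
  have "sqn \<mu> T' = sqn \<mu> (\<lambda>w. T (dil j w))"
    unfolding T'_def sqn_def by (simp add: norm_mult)
  then have T'2: "T' \<in> L2 \<mu>"
    using L2_dil[OF T(2), of j] T'1 by (simp add: L2_iff)
  define G where "G z = ift T (dil (- j) z) * cnj (f (vsub p z h))" for z
  have G [measurable]: "G \<in> borel_measurable \<mu>"
    unfolding G_def[abs_def]
    by (intro borel_measurable_times borel_measurable_cnj
        measurable_compose[OF measurable_dil borel_measurable_ift[OF m(1)]]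
        measurable_compose[OF measurable_vsub[OF h] m(2)])
  have "(\<integral>x. ift T x * cnj (of_real c * f (vsub p (dil j x) h)) \<partial>\<mu>) = (\<integral>x. of_real c * G (dil j x) \<partial>\<mu>)"
    by (simp add: G_def dil_dil mult_ac)
  also have "\<dots> = of_real c * (real p powi (- j) *\<^sub>R (\<integral>z. G z \<partial>\<mu>))"
    by (simp add: integral_dil[OF G])
  also have "(\<integral>z. G z \<partial>\<mu>) = (\<integral>y. G (vadd p h y) \<partial>\<mu>)"
    by (rule integral_vadd[symmetric, OF h G])
  also have "\<dots> = (\<integral>y. real p powi j *\<^sub>R (ift T' y * cnj (f y)) \<partial>\<mu>)"
  proof (rule Bochner_Integration.integral_cong[OF refl])
    fix y assume "y \<in> space \<mu>"
    then have y: "y \<in> vil p" by simp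
    have "vsub p (vadd p h y) h = y"
      using vsub_vadd[OF h y] by (simp add: vadd_commute)
    then show "G (vadd p h y) = real p powi j *\<^sub>R (ift T' y * cnj (f y))"
      by (simp add: G_def ift_dil_vadd[OF T(1) h y] T'_def[abs_def])
  qed
  also have "\<dots> = real p powi j *\<^sub>R (\<integral>y. ift T' y * cnj (f y) \<partial>\<mu>)"
    by simp
  also have "(\<integral>y. ift T' y * cnj (f y) \<partial>\<mu>) = (\<integral>w. T' w * cnj (fourier p \<mu> f w) \<partial>\<mu>)"
    by (rule Parseval[OF T'1 T'2 f])
  finally show ?thesis
    by (simp add: T'_def power_int_minus)
qed

text \<open>For \<open>w\<close> in one coset of \<open>vnbh p 0\<close> the values
  \<open>chi p w u\<close> coincide, so translation by \<open>u\<close> only contributes a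
  phase.\<close>

lemma ift_coset:
  assumes T: "\<And>w. w \<in> vil p \<Longrightarrow> w \<notin> cyl p e 0 \<Longrightarrow> T w = 0"
    and h: "h \<in> vil p" and u: "u \<in> vnbh p 0"
  shows "ift T (vadd p h u) = chi p e u * ift T h"
proof -
  have uv: "u \<in> vil p" using u by (simp add: vnbh_def)
  have "T w * chi p w (vadd p h u) = chi p e u * (T w * chi p w h)" if w: "w \<in> vil p" for w
  proof (cases "w \<in> cyl p e 0")
    case True
    then have "chi p w u = chi p e u"
      using u by (intro chi_cong[where n = 0]) (auto simp: cyl_def)
    then show ?thesis
      by (simp add: chi_vadd w h uv)
  qed (simp add: T w)
  then have "ift T (vadd p h u) = (\<integral>w. chi p e u * (T w * chi p w h) \<partial>\<mu>)"
    unfolding ift_def by (intro Bochner_Integration.integral_cong) simp_all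
  then show ?thesis by (simp add: ift_def)
qed

lemma norm_ift_coset:
  assumes "\<And>w. w \<in> vil p \<Longrightarrow> w \<notin> cyl p e 0 \<Longrightarrow> T w = 0" "h \<in> vil p" "x \<in> cyl p h 0"
  shows "cmod (ift T x) = cmod (ift T h)"
proof -
  obtain u where "u \<in> vnbh p 0" "x = vadd p h u"
    using assms(3) translate_vnbh[OF assms(2), of 0] by blast
  then show ?thesis
    using ift_coset[OF assms(1,2)] by (simp add: norm_mult)
qed

lemma finite_vH_vnbh: "finite (vH p \<inter> vnbh p (- int n))"
  by (rule finite_subset[OF _ finite_vil_support[of p "- int n" 0]]) (auto simp: vH_def vnbh_def)

text \<open>\<open>vH p\<close> represents the cosets of \<open>vnbh p 0\<close>, each of measure 1,
  and the modulus of \<open>ift T\<close> is constant on each of them. Sampling over H therefore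
  controls the integral; the window keeps the index set finite.\<close>

lemma sqn_vnbh_le_sum:
  assumes "\<And>w. w \<in> vil p \<Longrightarrow> w \<notin> cyl p e 0 \<Longrightarrow> T w = 0"
  shows "sqn \<mu> (\<lambda>x. indicator (vnbh p (- int n)) x * ift T x) \<le>
    (\<Sum>h\<in>vH p \<inter> vnbh p (- int n). ennreal ((cmod (ift T h))\<^sup>2))"
proof -
  let ?H = "vH p \<inter> vnbh p (- int n)"
  have Hv: "h \<in> vil p" if "h \<in> ?H" for h
    using that by (simp add: vH_def)
  have "sqn \<mu> (\<lambda>x. indicator (vnbh p (- int n)) x * ift T x) \<le>
      (\<integral>\<^sup>+x. (\<Sum>h\<in>?H. ennreal ((cmod (ift T h))\<^sup>2) * indicator (cyl p h 0) x) \<partial>\<mu>)"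
    unfolding sqn_def
  proof (rule nn_integral_mono)
    fix x assume "x \<in> space \<mu>"
    then have xv: "x \<in> vil p" by simp
    show "ennreal ((cmod (indicator (vnbh p (- int n)) x * ift T x))\<^sup>2) \<le>
        (\<Sum>h\<in>?H. ennreal ((cmod (ift T h))\<^sup>2) * indicator (cyl p h 0) x)"
    proof (cases "x \<in> vnbh p (- int n)")
      case True
      \<comment> \<open>Cutting \<open>x\<close> off after coordinate 0 yields its representative in
        \<open>vH p\<close>.\<close>
      define h where "h = (\<lambda>j. if j \<le> 0 then x j else 0)"
      have "h \<in> vil p"
        using xv by (auto simp: h_def vil_def)
      then have h: "h \<in> ?H"
        using True by (auto simp: vH_def vnbh_def h_def)
      have x: "x \<in> cyl p h 0"
        using xv by (simp add: cyl_def h_def)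
      have "ennreal ((cmod (ift T h))\<^sup>2) * indicator (cyl p h 0) x \<le>
          (\<Sum>h\<in>?H. ennreal ((cmod (ift T h))\<^sup>2) * indicator (cyl p h 0) x)"
        by (rule member_le_sum[OF h]) (auto simp: finite_vH_vnbh)
      then show ?thesis
        using norm_ift_coset[OF assms \<open>h \<in> vil p\<close> x] True x by simp
    qed simp
  qed
  also have "\<dots> = (\<Sum>h\<in>?H. \<integral>\<^sup>+x. ennreal ((cmod (ift T h))\<^sup>2) * indicator (cyl p h 0) x \<partial>\<mu>)"
    by (rule nn_integral_sum) measurable
  also have "\<dots> = (\<Sum>h\<in>?H. ennreal ((cmod (ift T h))\<^sup>2))"
    by (intro sum.cong refl) (simp add: nn_integral_cmult_indicator emeasure_cyl Hv)
  finally show ?thesis .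
qed

end

section \<open>Consequences of the frame property\<close>

locale vilenkin_pfmw = vilenkin +
  fixes \<psi> :: "nat \<Rightarrow> vseq \<Rightarrow> complex"
  assumes pfmw: "pfmw p \<mu> \<psi>"
begin

lemma psi_L2: "l \<in> {1..p - 1} \<Longrightarrow> \<psi> l \<in> L2 \<mu>"
  using pfmw unfolding pfmw_def by blast

lemma measurable_psi_hat: "l \<in> {1..p - 1} \<Longrightarrow> fourier p \<mu> (\<psi> l) \<in> borel_measurable \<mu>"
  using fourier_L2[OF psi_L2] by (simp add: L2_iff)

lemma frame_has_sum:
  assumes T: "integrable \<mu> T" "T \<in> L2 \<mu>"
  shows "((\<lambda>(j, h, l). (real p powr (of_int j / 2))\<^sup>2 *
      (cmod (\<integral>w. T (dil j w) * chi p w h * cnj (fourier p \<mu> (\<psi> l) w) \<partial>\<mu>))\<^sup>2)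
    has_sum (\<integral>x. (cmod (ift T x))\<^sup>2 \<partial>\<mu>)) (UNIV \<times> vH p \<times> {1..p - 1})"
proof -
  have "((\<lambda>i. (cmod (\<integral>x. ift T x * cnj (affine_system p \<psi> i x) \<partial>\<mu>))\<^sup>2)
      has_sum (\<integral>x. (cmod (ift T x))\<^sup>2 \<partial>\<mu>)) (UNIV \<times> vH p \<times> {1..p - 1})"
    using pfmw ift_L2[OF T] unfolding pfmw_def parseval_frame_def by blast
  moreover have "(cmod (\<integral>x. ift T x * cnj (affine_system p \<psi> (j, h, l) x) \<partial>\<mu>))\<^sup>2 =
      (real p powr (of_int j / 2))\<^sup>2 *
      (cmod (\<integral>w. T (dil j w) * chi p w h * cnj (fourier p \<mu> (\<psi> l) w) \<partial>\<mu>))\<^sup>2"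
    if "h \<in> vH p" "l \<in> {1..p - 1}" for j h l
  proof -
    have "h \<in> vil p" using that(1) by (simp add: vH_def)
    from frame_coefficient[OF T psi_L2[OF that(2)] this, of "real p powr (of_int j / 2)" j]
    show ?thesis
      by (simp add: affine_system_def norm_mult power_mult_distrib)
  qed
  ultimately show ?thesis
    by (subst has_sum_cong[where g = "\<lambda>i. (cmod (\<integral>x. ift T x * cnj (affine_system p \<psi> i x) \<partial>\<mu>))\<^sup>2"]) auto
qed

text \<open>The set is invariant under dilation, so the indicator of a piece \<open>A\<close> of it
  has zero coefficients at every scale and its \<open>ift\<close> has norm 0. If \<open>A\<close>
  lies in one coset of \<open>vnbh p 0\<close>, that \<open>ift\<close> has constant modulus
  \<open>measure \<mu> A\<close> on \<open>vnbh p 0\<close>, and \<open>A\<close> must be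
  null.\<close>

lemma psi_hat_vanish_null:
  "{w \<in> vil p. \<forall>j. \<forall>l\<in>{1..p - 1}. fourier p \<mu> (\<psi> l) (dil j w) = 0} \<in> null_sets \<mu>" (is "?N \<in> _")
proof -
  have "{w \<in> space \<mu>. \<forall>j. \<forall>l\<in>{1..p - 1}. fourier p \<mu> (\<psi> l) (dil j w) = 0} \<in> sets \<mu>"
  proof (intro sets.sets_Collect_countable_All sets.sets_Collect_finite_All)
    fix j l assume "l \<in> {1..p - 1}"
    then have "(\<lambda>w. fourier p \<mu> (\<psi> l) (dil j w)) \<in> borel_measurable \<mu>"
      by (intro measurable_compose[OF measurable_dil] measurable_psi_hat)
    then show "{w \<in> space \<mu>. fourier p \<mu> (\<psi> l) (dil j w) = 0} \<in> sets \<mu>"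
      by measurable
  qed simp
  then have N: "?N \<in> sets \<mu>" by simp
  have "?N \<inter> cyl p e 0 \<in> null_sets \<mu>" if e: "e \<in> vfin p" for e
  proof -
    define A where "A = ?N \<inter> cyl p e 0"
    let ?T = "indicator A :: vseq \<Rightarrow> complex"
    have ev: "e \<in> vil p" using e vfin_subset by blast
    have A: "A \<in> sets \<mu>" unfolding A_def by (intro sets.Int N sets_cyl)
    have fin: "emeasure \<mu> A < \<infinity>"
      using emeasure_mono[of A "cyl p e 0" \<mu>] ev by (auto simp: A_def emeasure_cyl intro: le_less_trans)
    have T: "integrable \<mu> ?T" "?T \<in> L2 \<mu>"
    proof -
      have "integrable \<mu> (\<lambda>w. indicator A w * 1 :: complex)"
        by (rule integrable_indicator_bounded[where C = 1]) (use A fin in auto)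
      then show "integrable \<mu> ?T" by simp
      have "sqn \<mu> ?T = emeasure \<mu> A"
      proof -
        have "sqn \<mu> ?T = (\<integral>\<^sup>+w. indicator A w \<partial>\<mu>)"
          unfolding sqn_def by (intro nn_integral_cong) (auto split: split_indicator)
        then show ?thesis using A by simp
      qed
      then show "?T \<in> L2 \<mu>"
        using fin A by (simp add: L2_iff)
    qed
    have zero: "(\<integral>w. ?T (dil j w) * chi p w h * cnj (fourier p \<mu> (\<psi> l) w) \<partial>\<mu>) = 0"
      if l: "l \<in> {1..p - 1}" for j h l
    proof -
      have "?T (dil j w) * chi p w h * cnj (fourier p \<mu> (\<psi> l) w) = 0" for w
      proof (cases "dil j w \<in> A")
        case True
        \<comment> \<open>Membership in the set covers every exponent, in particular the one that
          undoes \<open>dil j\<close>.\<close>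
        then have "fourier p \<mu> (\<psi> l) (dil (- j) (dil j w)) = 0" using l unfolding A_def by blast
        then show ?thesis by (simp add: dil_dil)
      qed simp
      then show ?thesis by (simp only: Bochner_Integration.integral_zero)
    qed
    let ?F = "\<lambda>(j, h, l). (real p powr (of_int j / 2))\<^sup>2 *
      (cmod (\<integral>w. ?T (dil j w) * chi p w h * cnj (fourier p \<mu> (\<psi> l) w) \<partial>\<mu>))\<^sup>2"
    have "?F i = 0" if "i \<in> UNIV \<times> vH p \<times> {1..p - 1}" for i
    proof -
      from that obtain j h l where "i = (j, h, l)" "l \<in> {1..p - 1}" by (cases i) blast
      then show ?thesis by (simp only: zero case_prod_conv) simp
    qed
    then have "(?F has_sum (\<integral>x. (cmod (ift ?T x))\<^sup>2 \<partial>\<mu>)) (UNIV \<times> vH p \<times> {1..p - 1}) =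
        ((\<lambda>_. 0) has_sum (\<integral>x. (cmod (ift ?T x))\<^sup>2 \<partial>\<mu>)) ((UNIV :: int set) \<times> vH p \<times> {1..p - 1})"
      by (rule has_sum_cong)
    with frame_has_sum[OF T]
    have "((\<lambda>_. 0) has_sum (\<integral>x. (cmod (ift ?T x))\<^sup>2 \<partial>\<mu>)) ((UNIV :: int set) \<times> vH p \<times> {1..p - 1})"
      by (simp only:)
    then have "(\<integral>x. (cmod (ift ?T x))\<^sup>2 \<partial>\<mu>) = 0"
      using has_sum_unique has_sum_0_simp by blast
    then have sqn0: "sqn \<mu> (ift ?T) = 0"
      using sqn_integral[OF ift_L2[OF T]] by simp
    have "ennreal ((measure \<mu> A)\<^sup>2) = (\<integral>\<^sup>+x. ennreal ((measure \<mu> A)\<^sup>2) * indicator (vnbh p 0) x \<partial>\<mu>)"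
      using emeasure_vnbh[of 0] by (simp add: nn_integral_cmult_indicator)
    also have "\<dots> \<le> sqn \<mu> (ift ?T)"
      unfolding sqn_def
    proof (rule nn_integral_mono)
      fix x
      show "ennreal ((measure \<mu> A)\<^sup>2) * indicator (vnbh p 0) x \<le> ennreal ((cmod (ift ?T x))\<^sup>2)"
      proof (cases "x \<in> vnbh p 0")
        case True
        have "?T w * chi p w x = chi p e x * of_real (indicator A w)" for w
        proof (cases "w \<in> A")
          case wA: True
          then have "chi p w x = chi p e x"
            using True by (intro chi_cong[where n = 0]) (auto simp: A_def cyl_def)
          with wA show ?thesis by simp
        qed simp
        then have "ift ?T x = chi p e x * (\<integral>w. of_real (indicator A w) \<partial>\<mu>)"
          unfolding ift_def by (simp only: integral_mult_right_zero)
        also have "(\<integral>w. of_real (indicator A w) \<partial>\<mu> :: complex) = of_real (measure \<mu> A)"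
          using sets.sets_into_space[OF A] by (simp only: integral_complex_of_real) (simp add: Int_absorb2)
        finally show ?thesis by (simp add: norm_mult True)
      qed simp
    qed
    finally have "measure \<mu> A = 0"
      using sqn0 by simp
    then have "emeasure \<mu> A = 0"
      using fin by (auto simp: measure_def enn2real_eq_0_iff)
    then show ?thesis using A unfolding A_def by (intro null_setsI)
  qed
  then have "(\<Union>e\<in>vfin p. ?N \<inter> cyl p e 0) \<in> null_sets \<mu>"
    using countable_vfin by (intro null_sets_UN') auto
  moreover have "?N = (\<Union>e\<in>vfin p. ?N \<inter> cyl p e 0)"
  proof (intro equalityI subsetI)
    fix w assume w: "w \<in> ?N"
    then have "w \<in> vil p" by simp
    then obtain e where "e \<in> vfin p" "cyl p w 0 = cyl p e 0"
      by (rule cyl_trunc)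
    moreover have "w \<in> cyl p w 0" using \<open>w \<in> vil p\<close> by (simp add: cyl_def)
    ultimately show "w \<in> (\<Union>e\<in>vfin p. ?N \<inter> cyl p e 0)" using w by blast
  qed blast
  ultimately show ?thesis by metis
qed


section \<open>Square summability of the transforms over nonnegative scales\<close>

definition psi_piece :: "vseq \<Rightarrow> nat \<Rightarrow> nat \<Rightarrow> vseq \<Rightarrow> complex" where
  "psi_piece e j l w = indicator (cyl p (dil (- int j) e) (int j)) w * cnj (fourier p \<mu> (\<psi> l) w)"

lemma psi_piece:
  assumes "e \<in> vil p" "l \<in> {1..p - 1}"
  shows "psi_piece e j l \<in> L2 \<mu>" "integrable \<mu> (psi_piece e j l)"
proof -
  have "emeasure \<mu> (cyl p (dil (- int j) e) (int j)) < \<infinity>"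
    using assms by (simp add: emeasure_cyl)
  then show "psi_piece e j l \<in> L2 \<mu>" "integrable \<mu> (psi_piece e j l)"
    unfolding psi_piece_def[abs_def]
    by (intro L2_indicator integrable_indicator_L2 L2_cnj fourier_L2 psi_L2 assms sets_cyl; assumption)+
qed

text \<open>The support of the piece is the preimage under \<open>dil (int j)\<close> of the coset
  of \<open>vnbh p 0\<close> through \<open>e\<close>, the form that occurs in a frame coefficient.
  As a coset of level \<open>int j\<close>, with \<open>j\<close> natural, it also lies in a single
  coset of \<open>vnbh p 0\<close>, as sampling requires.\<close>

lemma psi_piece_eq:
  assumes "w \<in> vil p"
  shows "psi_piece e j l w = indicator (cyl p e 0) (dil (int j) w) * cnj (fourier p \<mu> (\<psi> l) w)"
  using dil_vimage_cyl[of "int j" e 0] assms unfolding psi_piece_def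
  by (auto simp: set_eq_iff split: split_indicator)

text \<open>The summands dominate nothing but frame coefficients: up to the weight p^j, those of the
  test function are the samples of \<open>ift (psi_piece e j l)\<close> on H. The bound 1 is the
  measure of the coset of \<open>e\<close>, and with \<open>J\<close> and \<open>n\<close> fixed
  only finitely many coefficients occur.\<close>

lemma psi_piece_frame_bound:
  assumes e: "e \<in> vil p"
  shows "(\<Sum>j<J. \<Sum>l\<in>{1..p - 1}. ennreal (real p ^ j) *
    sqn \<mu> (\<lambda>x. indicator (vnbh p (- int n)) x * ift (psi_piece e j l) x)) \<le> 1"
proof -
  let ?T = "indicator (cyl p e 0) :: vseq \<Rightarrow> complex"
  let ?H = "vH p \<inter> vnbh p (- int n)" and ?L = "{1..p - 1}"
  let ?c = "\<lambda>j h l. real p ^ j * (cmod (ift (psi_piece e j l) h))\<^sup>2"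
  let ?F = "\<lambda>(j, h, l). (real p powr (of_int j / 2))\<^sup>2 *
      (cmod (\<integral>w. ?T (dil j w) * chi p w h * cnj (fourier p \<mu> (\<psi> l) w) \<partial>\<mu>))\<^sup>2"
  have T1: "integrable \<mu> ?T"
  proof -
    have "integrable \<mu> (\<lambda>w. indicator (cyl p e 0) w * 1 :: complex)"
      by (rule integrable_indicator_bounded[where C = 1]) (simp_all add: emeasure_cyl e)
    then show ?thesis by simp
  qed
  have sT: "sqn \<mu> ?T = 1"
  proof -
    have "sqn \<mu> ?T = (\<integral>\<^sup>+w. indicator (cyl p e 0) w \<partial>\<mu>)"
      unfolding sqn_def by (intro nn_integral_cong) (auto split: split_indicator)
    then show ?thesis by (simp add: emeasure_cyl e)
  qed
  have T2: "?T \<in> L2 \<mu>"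
    by (simp add: L2_iff sT)
  have F: "?F (int j, h, l) = ?c j h l" for j h l
  proof -
    have "(real p powr (of_int (int j) / 2))\<^sup>2 = real p ^ j"
      by (simp add: power2_eq_square powr_add[symmetric] powr_realpow)
    moreover have "(\<integral>w. ?T (dil (int j) w) * chi p w h * cnj (fourier p \<mu> (\<psi> l) w) \<partial>\<mu>) = ift (psi_piece e j l) h"
      unfolding ift_def by (rule Bochner_Integration.integral_cong) (simp_all add: psi_piece_eq mult_ac)
    ultimately show ?thesis by (simp only: case_prod_conv)
  qed
  have "(\<Sum>j<J. \<Sum>l\<in>?L. \<Sum>h\<in>?H. ?c j h l) \<le> (\<integral>x. (cmod (ift ?T x))\<^sup>2 \<partial>\<mu>)"
  proof -
    let ?g = "\<lambda>(j, h, l). (int j, h, l :: nat)"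
    let ?B = "?g ` ({..<J} \<times> ?H \<times> ?L)"
    have "(\<Sum>j<J. \<Sum>l\<in>?L. \<Sum>h\<in>?H. ?c j h l) = (\<Sum>j<J. \<Sum>h\<in>?H. \<Sum>l\<in>?L. ?c j h l)"
      by (intro sum.cong refl sum.swap)
    also have "\<dots> = (\<Sum>(j, h, l)\<in>{..<J} \<times> ?H \<times> ?L. ?c j h l)"
      by (simp add: sum.cartesian_product)
    also have "\<dots> = (\<Sum>z\<in>{..<J} \<times> ?H \<times> ?L. ?F (?g z))"
    proof (rule sum.cong[OF refl])
      fix z :: "nat \<times> vseq \<times> nat"
      obtain j h l where "z = (j, h, l)" by (cases z) blast
      then show "(case z of (j, h, l) \<Rightarrow> ?c j h l) = ?F (?g z)"
        using F[of j h l] by (simp only: case_prod_conv)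
    qed
    also have "\<dots> = sum ?F ?B"
      by (rule sum.reindex[unfolded o_def, symmetric]) (auto simp: inj_on_def)
    also have "\<dots> \<le> (\<integral>x. (cmod (ift ?T x))\<^sup>2 \<partial>\<mu>)"
    proof (rule finite_sum_le_has_sum[OF frame_has_sum[OF T1 T2]])
      show "finite ?B" by (intro finite_imageI finite_cartesian_product finite_vH_vnbh) simp_all
      show "?B \<subseteq> UNIV \<times> vH p \<times> ?L" by auto
    qed (auto intro!: mult_nonneg_nonneg)
    finally show ?thesis .
  qed
  then have "ennreal (\<Sum>j<J. \<Sum>l\<in>?L. \<Sum>h\<in>?H. ?c j h l) \<le> ennreal (\<integral>x. (cmod (ift ?T x))\<^sup>2 \<partial>\<mu>)"
    by (rule ennreal_leI)
  also have "\<dots> = sqn \<mu> (ift ?T)"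
    by (rule sqn_integral[OF ift_L2[OF T1 T2]])
  also have "\<dots> \<le> 1"
    using Bessel_ift[OF T1] by (simp only: sT)
  finally have le1: "ennreal (\<Sum>j<J. \<Sum>l\<in>?L. \<Sum>h\<in>?H. ?c j h l) \<le> 1" .
  have "(\<Sum>j<J. \<Sum>l\<in>?L. ennreal (real p ^ j) *
      sqn \<mu> (\<lambda>x. indicator (vnbh p (- int n)) x * ift (psi_piece e j l) x)) \<le>
    (\<Sum>j<J. \<Sum>l\<in>?L. ennreal (real p ^ j) * (\<Sum>h\<in>?H. ennreal ((cmod (ift (psi_piece e j l) h))\<^sup>2)))"
  proof (intro sum_mono mult_left_mono sqn_vnbh_le_sum)
    fix j l w assume "w \<in> vil p" "w \<notin> cyl p (dil (- int j) e) 0"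
    then show "psi_piece e j l w = 0"
      by (auto simp: psi_piece_def cyl_def split: split_indicator)
  qed simp
  also have "\<dots> = ennreal (\<Sum>j<J. \<Sum>l\<in>?L. \<Sum>h\<in>?H. ?c j h l)"
    by (simp add: sum_nonneg ennreal_mult sum_distrib_left flip: sum_ennreal)
  finally show ?thesis using le1 by (rule order_trans)
qed

lemma psi_piece_sum_bound:
  assumes e: "e \<in> vil p"
  shows "(\<Sum>j<J. \<Sum>l\<in>{1..p - 1}. ennreal (real p ^ j) * sqn \<mu> (ift (psi_piece e j l))) \<le> 1"
proof (rule LIMSEQ_le_const2)
  show "(\<lambda>n. \<Sum>j<J. \<Sum>l\<in>{1..p - 1}. ennreal (real p ^ j) *
      sqn \<mu> (\<lambda>x. indicator (vnbh p (- int n)) x * ift (psi_piece e j l) x))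
    \<longlonglongrightarrow> (\<Sum>j<J. \<Sum>l\<in>{1..p - 1}. ennreal (real p ^ j) * sqn \<mu> (ift (psi_piece e j l)))"
  proof (intro tendsto_sum ennreal_tendsto_cmult sqn_vnbh_LIMSEQ borel_measurable_ift)
    show "psi_piece e j l \<in> borel_measurable \<mu>" if "l \<in> {1..p - 1}" for j l
      using psi_piece(1)[OF e that] by (rule L2D)
  qed simp
qed (use psi_piece_frame_bound[OF e] in blast)

text \<open>Substituting \<open>dil (int j)\<close> moves the integral to the shrunken coset at the
  price of the Jacobian p^j, the same weight as in the frame bound. The 4 comes from the lower bound
  for \<open>ift\<close>.\<close>

lemma nn_integral_psi_hat_le:
  assumes e: "e \<in> vil p" and l: "l \<in> {1..p - 1}"
  shows "(\<integral>\<^sup>+w. indicator (cyl p e 0) w * ennreal ((cmod (fourier p \<mu> (\<psi> l) (dil (- int j) w)))\<^sup>2) \<partial>\<mu>) \<le>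
    4 * (ennreal (real p ^ j) * sqn \<mu> (ift (psi_piece e j l)))"
proof -
  let ?G = "\<lambda>w. indicator (cyl p e 0) w * ennreal ((cmod (fourier p \<mu> (\<psi> l) (dil (- int j) w)))\<^sup>2)"
  have m: "(\<lambda>w. fourier p \<mu> (\<psi> l) (dil (- int j) w)) \<in> borel_measurable \<mu>"
    by (intro measurable_compose[OF measurable_dil] measurable_psi_hat l)
  have "?G \<in> borel_measurable \<mu>"
    using m by measurable
  then have "(\<integral>\<^sup>+w. ?G (dil (int j) w) \<partial>\<mu>) = ennreal (real p powi (- int j)) * (\<integral>\<^sup>+w. ?G w \<partial>\<mu>)"
    by (rule nn_integral_dil)
  moreover have "(\<integral>\<^sup>+w. ?G (dil (int j) w) \<partial>\<mu>) = sqn \<mu> (psi_piece e j l)"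
    unfolding sqn_def
    by (intro nn_integral_cong) (auto simp: psi_piece_eq dil_dil norm_mult split: split_indicator)
  ultimately have "ennreal (real p powi int j) * sqn \<mu> (psi_piece e j l) =
      (ennreal (real p powi (- int j)) * ennreal (real p powi int j)) * (\<integral>\<^sup>+w. ?G w \<partial>\<mu>)"
    by (simp only: mult_ac)
  then have "(\<integral>\<^sup>+w. ?G w \<partial>\<mu>) = ennreal (real p powi int j) * sqn \<mu> (psi_piece e j l)"
    by (simp only: powi_minus mult_1)
  also have "real p powi int j = real p ^ j"
    by simp
  also have "ennreal (real p ^ j) * sqn \<mu> (psi_piece e j l) \<le> ennreal (real p ^ j) * (4 * sqn \<mu> (ift (psi_piece e j l)))"
  proof (rule mult_left_mono)
    show "sqn \<mu> (psi_piece e j l) \<le> 4 * sqn \<mu> (ift (psi_piece e j l))"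
      using Plancherel_lower_fourier[OF psi_L2[OF l], of "dil (- int j) e" "int j"] e
      by (simp add: psi_piece_def[abs_def])
  qed simp
  finally show ?thesis by (simp only: mult_ac)
qed

text \<open>The integral of the series over a coset of \<open>vnbh p 0\<close> is at most 4, so the
  series is finite almost everywhere on it; countably many such cosets cover the group.\<close>

lemma psi_hat_sum_finite:
  "AE w in \<mu>. (\<Sum>j. \<Sum>l\<in>{1..p - 1}. ennreal ((cmod (fourier p \<mu> (\<psi> l) (dil (- int j) w)))\<^sup>2)) \<noteq> top"
proof -
  let ?f = "\<lambda>j w. \<Sum>l\<in>{1..p - 1}. ennreal ((cmod (fourier p \<mu> (\<psi> l) (dil (- int j) w)))\<^sup>2)"
  have m: "(\<lambda>w. fourier p \<mu> (\<psi> l) (dil (- int j) w)) \<in> borel_measurable \<mu>" if "l \<in> {1..p - 1}" for j l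
    by (intro measurable_compose[OF measurable_dil] measurable_psi_hat that)
  have mn: "(\<lambda>w. ennreal ((cmod (fourier p \<mu> (\<psi> l) (dil (- int j) w)))\<^sup>2)) \<in> borel_measurable \<mu>"
    if "l \<in> {1..p - 1}" for j l
    using m[OF that] by measurable
  have fm: "?f j \<in> borel_measurable \<mu>" for j
    by (intro borel_measurable_sum mn)
  have "AE w in \<mu>. w \<in> cyl p e 0 \<longrightarrow> (\<Sum>j. ?f j w) \<noteq> top" if "e \<in> vfin p" for e
  proof -
    have e: "e \<in> vil p" using that vfin_subset by blast
    have im: "(\<lambda>w. indicator (cyl p e 0) w * ?f j w) \<in> borel_measurable \<mu>" for j
      by (intro borel_measurable_times_ennreal borel_measurable_indicator sets_cyl fm)
    have "(\<integral>\<^sup>+w. (\<Sum>j. indicator (cyl p e 0) w * ?f j w) \<partial>\<mu>) = (\<Sum>j. \<integral>\<^sup>+w. indicator (cyl p e 0) w * ?f j w \<partial>\<mu>)"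
      by (rule nn_integral_suminf[OF im])
    also have "\<dots> \<le> 4"
      unfolding suminf_eq_SUP
    proof (rule SUP_least)
      fix J
      have "(\<Sum>j<J. \<integral>\<^sup>+w. indicator (cyl p e 0) w * ?f j w \<partial>\<mu>) =
          (\<Sum>j<J. \<Sum>l\<in>{1..p - 1}. \<integral>\<^sup>+w. indicator (cyl p e 0) w * ennreal ((cmod (fourier p \<mu> (\<psi> l) (dil (- int j) w)))\<^sup>2) \<partial>\<mu>)"
        unfolding sum_distrib_left
        by (intro sum.cong refl nn_integral_sum borel_measurable_times_ennreal borel_measurable_indicator sets_cyl mn)
      also have "\<dots> \<le> (\<Sum>j<J. \<Sum>l\<in>{1..p - 1}. 4 * (ennreal (real p ^ j) * sqn \<mu> (ift (psi_piece e j l))))"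
        by (intro sum_mono nn_integral_psi_hat_le e)
      also have "\<dots> = 4 * (\<Sum>j<J. \<Sum>l\<in>{1..p - 1}. ennreal (real p ^ j) * sqn \<mu> (ift (psi_piece e j l)))"
        by (simp only: sum_distrib_left)
      also have "\<dots> \<le> 4 * 1"
        by (intro mult_left_mono psi_piece_sum_bound e) simp
      finally show "(\<Sum>j<J. \<integral>\<^sup>+w. indicator (cyl p e 0) w * ?f j w \<partial>\<mu>) \<le> 4" by simp
    qed
    finally have "(\<integral>\<^sup>+w. (\<Sum>j. indicator (cyl p e 0) w * ?f j w) \<partial>\<mu>) \<noteq> \<infinity>"
      by (auto simp: top_unique)
    then have "AE w in \<mu>. (\<Sum>j. indicator (cyl p e 0) w * ?f j w) \<noteq> \<infinity>"
      by (rule nn_integral_noteq_infinite[rotated]) (intro borel_measurable_suminf_order im)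
    then show ?thesis
      by eventually_elim (auto split: split_indicator_asm)
  qed
  then have "AE w in \<mu>. \<forall>e\<in>vfin p. w \<in> cyl p e 0 \<longrightarrow> (\<Sum>j. ?f j w) \<noteq> top"
    by (intro AE_ball_countable[THEN iffD2] countable_vfin ballI)
  with AE_space show ?thesis
  proof eventually_elim
    case (elim w)
    then have "w \<in> vil p" by simp
    then obtain e where "e \<in> vfin p" "cyl p w 0 = cyl p e 0"
      by (rule cyl_trunc)
    moreover have "w \<in> cyl p w 0" using \<open>w \<in> vil p\<close> by (simp add: cyl_def)
    ultimately show ?case using elim by blast
  qed
qed

end

section \<open>The low-pass property\<close>

text \<open>In the application \<open>a k\<close> and \<open>b k\<close> are the moduli of the
  transform of \<open>\<phi>\<close> and of \<open>m 0\<close> at \<open>dil k w\<close>. Iterating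
  \<open>step\<close> backwards from \<open>- int i\<close> bounds \<open>a (- int i)\<close> by
  \<open>C\<close> times the infinite product started there. These products tend to 0, while
  \<open>a\<close> is nonincreasing, so each \<open>a k\<close> is squeezed to 0.\<close>

lemma scaling_orbit_vanishes:
  fixes a b :: "int \<Rightarrow> real"
  assumes b: "\<And>k. 0 \<le> b k" "\<And>k. b k \<le> 1" and a: "\<And>k. 0 \<le> a k"
    and step: "\<And>k. a (k + 1) = b k * a k"
    and bound: "\<And>n. a (- int n) \<le> C"
    and lim: "(\<lambda>i. lim (\<lambda>n. \<Prod>j=1..n. b (- int i - int j))) \<longlonglongrightarrow> 0"
  shows "a k = 0"
proof -
  let ?P = "\<lambda>i n. \<Prod>j=1..n. b (- int i - int j)"
  have mono: "a (k + 1) \<le> a k" for k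
    using mult_right_mono[OF b(2)[of k] a[of k]] by (simp add: step)
  have anti: "a (k + int n) \<le> a k" for k n
  proof (induction n)
    case (Suc n)
    then show ?case using mono[of "k + int n"] by (simp add: algebra_simps)
  qed simp
  have prod: "a (- int i) = ?P i n * a (- int i - int n)" for i n
  proof (induction n)
    case (Suc n)
    have "a (- int i - int n) = b (- int i - int (Suc n)) * a (- int i - int (Suc n))"
      using step[of "- int i - int (Suc n)"] by (simp add: algebra_simps)
    with Suc show ?case by simp
  qed simp
  have P0: "0 \<le> ?P i n" for i n
    by (intro prod_nonneg b ballI)
  have dec: "decseq (?P i)" for i
  proof (rule decseq_SucI)
    fix n
    show "?P i (Suc n) \<le> ?P i n"
      using mult_left_mono[OF b(2) P0] by simp
  qed
  have "convergent (?P i)" for i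
    by (rule decseq_convergent[OF dec[of i] allI[OF P0[of i]]]) (rule convergentI)
  then have Plim: "?P i \<longlonglongrightarrow> lim (?P i)" for i
    by (simp add: convergent_LIMSEQ_iff)
  have le: "a (- int i) \<le> lim (?P i) * C" for i
  proof (rule LIMSEQ_le_const)
    show "(\<lambda>n. ?P i n * C) \<longlonglongrightarrow> lim (?P i) * C"
      by (intro tendsto_intros Plim)
    have "a (- int i) \<le> ?P i n * C" for n
      using mult_left_mono[OF bound[of "i + n"] P0[of i n]] prod[of i n] by simp
    then show "\<exists>N. \<forall>n\<ge>N. a (- int i) \<le> ?P i n * C" by blast
  qed
  have "a k \<le> 0 * C"
  proof (rule LIMSEQ_le_const)
    show "(\<lambda>i. lim (?P i) * C) \<longlonglongrightarrow> 0 * C"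
      by (intro tendsto_intros lim)
    have "a k \<le> lim (?P i) * C" if "nat (- k) \<le> i" for i
    proof -
      have "- int i + int (nat (k + int i)) = k" using that by simp
      then show ?thesis using le[of i] anti[of "- int i" "nat (k + int i)"] by simp
    qed
    then show "\<exists>N. \<forall>n\<ge>N. a k \<le> lim (?P n) * C" by blast
  qed
  with a[of k] show ?thesis by simp
qed

context vilenkin
begin

lemma sets_N0:
  assumes m0: "m0 \<in> borel_measurable \<mu>"
  shows "N0 p m0 \<in> sets \<mu>"
proof -
  have md: "(\<lambda>w. m0 (dil k w)) \<in> borel_measurable \<mu>" for k
    by (rule measurable_compose[OF measurable_dil m0])
  have mn: "(\<lambda>w. cmod (m0 (dil k w))) \<in> borel_measurable \<mu>" for k
    using md by measurable
  have phi: "phi_hat_abs m0 \<in> borel_measurable \<mu>"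
    unfolding phi_hat_abs_def[abs_def]
    by (intro borel_measurable_lim_metric borel_measurable_prod mn)
  have X: "(\<lambda>w. phi_hat_abs m0 (dil k w)) \<in> borel_measurable \<mu>" for k
    by (rule measurable_compose[OF measurable_dil phi])
  let ?X = "\<lambda>j w. phi_hat_abs m0 (dil (- int j) w)"
  have "{w \<in> space \<mu>. Cauchy (\<lambda>j. ?X j w)} \<in> sets \<mu>"
    by (rule sets_Collect_Cauchy[OF X])
  moreover have "{w \<in> space \<mu>. lim (\<lambda>j. ?X j w) = 0} \<in> sets \<mu>"
  proof -
    have "(\<lambda>w. lim (\<lambda>j. ?X j w)) \<in> borel_measurable \<mu>"
      by (rule borel_measurable_lim_metric[OF X])
    then show ?thesis by measurable
  qed
  moreover have "N0 p m0 = {w \<in> space \<mu>. Cauchy (\<lambda>j. ?X j w)} \<inter> {w \<in> space \<mu>. lim (\<lambda>j. ?X j w) = 0}"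
  proof -
    \<comment> \<open>The value of \<open>lim\<close> for a divergent sequence is arbitrary and
      could be 0, so convergence is tested separately through the Cauchy property.\<close>
    have "Y \<longlonglongrightarrow> 0 \<longleftrightarrow> Cauchy Y \<and> lim Y = 0" for Y :: "nat \<Rightarrow> real"
      unfolding Cauchy_convergent_iff convergent_LIMSEQ_iff by (metis limI)
    then show ?thesis by (auto simp: N0_def)
  qed
  ultimately show ?thesis by simp
qed

end

context vilenkin_pfmw
begin

text \<open>Every almost everywhere relation is first made to hold at all \<open>dil k w\<close>
  simultaneously. What remains takes place on a single orbit and concerns the real sequences
  \<open>a\<close>, \<open>b\<close> and \<open>d\<close>.\<close>

lemma N0_null:
  assumes m: "m \<in> gen_filters_of p \<mu> \<phi>"
    and s: "\<forall>i\<in>{1..p-1}. unimodular p \<mu> (s i)"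
    and psi: "\<forall>i\<in>{1..p-1}. AE w in \<mu>. fourier p \<mu> (\<psi> i) (dil 1 w) =
      Wstar p \<alpha> w * s i (dil 1 w) * cnj (m i w) * fourier p \<mu> \<phi> w"
  shows "N0 p (m 0) \<in> null_sets \<mu>"
proof -
  let ?F = "fourier p \<mu> \<phi>"
  have m0: "m 0 \<in> borel_measurable \<mu>"
    using m p_pos unfolding gen_filters_of_def gen_filters_def by blast
  have 1: "AE w in \<mu>. \<forall>k. ?F (dil 1 (dil k w)) = m 0 (dil k w) * ?F (dil k w)"
    using m unfolding gen_filters_of_def AE_all_countable by (intro allI AE_dil) simp
  have "AE w in \<mu>. (\<Sum>i<p. (cmod (m i w))\<^sup>2) = 1"
    using m unfolding gen_filters_of_def gen_filters_def by (auto elim!: AE_mp)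
  then have 2: "AE w in \<mu>. \<forall>k. (\<Sum>i<p. (cmod (m i (dil k w)))\<^sup>2) = 1"
    unfolding AE_all_countable by (intro allI AE_dil)
  have "AE w in \<mu>. \<forall>i\<in>{1..p-1}. fourier p \<mu> (\<psi> i) (dil 1 w) =
      Wstar p \<alpha> w * s i (dil 1 w) * cnj (m i w) * ?F w"
    using psi by (intro AE_finite_allI) auto
  then have 3: "AE w in \<mu>. \<forall>k. \<forall>i\<in>{1..p-1}. fourier p \<mu> (\<psi> i) (dil 1 (dil k w)) =
      Wstar p \<alpha> (dil k w) * s i (dil 1 (dil k w)) * cnj (m i (dil k w)) * ?F (dil k w)"
    unfolding AE_all_countable by (intro allI AE_dil)
  have 4: "AE w in \<mu>. w \<notin> {w \<in> vil p. \<forall>j. \<forall>l\<in>{1..p - 1}. fourier p \<mu> (\<psi> l) (dil j w) = 0}"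
    by (rule AE_not_in[OF psi_hat_vanish_null])
  have "AE w in \<mu>. w \<notin> N0 p (m 0)"
    using AE_space 1 2 3 4 psi_hat_sum_finite
  proof eventually_elim
    case (elim w)
    have w: "w \<in> vil p" using elim(1) by simp
    define a where "a k = cmod (?F (dil k w))" for k
    define b where "b k = cmod (m 0 (dil k w))" for k
    define d where "d k = (\<Sum>l\<in>{1..p - 1}. (cmod (fourier p \<mu> (\<psi> l) (dil k w)))\<^sup>2)" for k
    have step: "a (k + 1) = b k * a k" for k
      using elim(2)[rule_format, of k] by (simp add: a_def b_def norm_mult dil_dil add.commute)
    have split: "{..<p} = insert 0 {1..p - 1}"
      using p_pos by auto
    have msum: "(\<Sum>i\<in>{1..p - 1}. (cmod (m i (dil k w)))\<^sup>2) = 1 - (b k)\<^sup>2" for k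
      using elim(3)[rule_format, of k] unfolding split b_def by simp
    have b1: "b k \<le> 1" for k
    proof -
      have "0 \<le> 1 - (b k)\<^sup>2"
        unfolding msum[symmetric] by (intro sum_nonneg) simp
      then show ?thesis by (intro power2_le_imp_le[of "b k" 1]) simp_all
    qed
    have psi_norm: "cmod (fourier p \<mu> (\<psi> l) (dil (k + 1) w)) = cmod (m l (dil k w)) * a k"
      if l: "l \<in> {1..p - 1}" for k l
    proof -
      have "cmod (s l (dil 1 (dil k w))) = 1"
        using s l w unfolding unimodular_def by simp
      moreover have "fourier p \<mu> (\<psi> l) (dil 1 (dil k w)) =
        Wstar p \<alpha> (dil k w) * s l (dil 1 (dil k w)) * cnj (m l (dil k w)) * ?F (dil k w)"
        using elim(4) l by blast
      ultimately show ?thesis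
        by (simp add: norm_mult Wstar_def a_def dil_dil add.commute)
    qed
    \<comment> \<open>The unimodular factors drop out of \<open>psi_norm\<close>, and the filter
      identity then makes \<open>d\<close> a difference of consecutive squares, ready to
      telescope.\<close>
    have d: "d (k + 1) = (a k)\<^sup>2 - (a (k + 1))\<^sup>2" for k
    proof -
      have "d (k + 1) = (\<Sum>l\<in>{1..p - 1}. (cmod (m l (dil k w)))\<^sup>2 * (a k)\<^sup>2)"
        unfolding d_def by (intro sum.cong refl) (simp only: psi_norm power_mult_distrib)
      also have "\<dots> = (1 - (b k)\<^sup>2) * (a k)\<^sup>2"
        by (simp only: sum_distrib_right[symmetric] msum)
      finally show ?thesis
        by (simp add: step power_mult_distrib left_diff_distrib)
    qed
    have d0: "0 \<le> d k" for k
      unfolding d_def by (intro sum_nonneg) simp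
    have "(\<Sum>j. ennreal (d (- int j))) \<noteq> top"
      using elim(6) unfolding d_def by simp
    then have summable: "summable (\<lambda>j. d (- int j))"
      by (intro summable_suminf_not_top d0)
    \<comment> \<open>Telescoping from 0 back to \<open>- int n\<close> bounds the square of
      \<open>a (- int n)\<close> by the whole series plus \<open>(a 0)\<^sup>2\<close>, a constant
      independent of \<open>n\<close>.\<close>
    define C where "C = sqrt ((\<Sum>j. d (- int j)) + (a 0)\<^sup>2)"
    have bound: "a (- int n) \<le> C" for n
    proof -
      have "(\<Sum>j<n. d (- int j)) = (a (- int n))\<^sup>2 - (a 0)\<^sup>2"
      proof (induction n)
        case (Suc n)
        moreover have "d (- int n) = (a (- int (Suc n)))\<^sup>2 - (a (- int n))\<^sup>2"
          using d[of "- int (Suc n)"] by simp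
        ultimately show ?case unfolding sum.lessThan_Suc by linarith
      qed simp
      moreover have "(\<Sum>j<n. d (- int j)) \<le> (\<Sum>j. d (- int j))"
        by (rule sum_le_suminf[OF summable]) (auto simp: d0)
      ultimately have "(a (- int n))\<^sup>2 \<le> (\<Sum>j. d (- int j)) + (a 0)\<^sup>2"
        by linarith
      then show ?thesis
        unfolding C_def by (rule real_le_rsqrt)
    qed
    show ?case
    proof
      assume "w \<in> N0 p (m 0)"
      then have "(\<lambda>i. lim (\<lambda>n. \<Prod>j=1..n. b (- int i - int j))) \<longlonglongrightarrow> 0"
        by (simp add: N0_def phi_hat_abs_def b_def dil_dil add.commute)
      then have a0: "a k = 0" for k
        using scaling_orbit_vanishes[of b a C k] b1 step bound by (simp add: a_def b_def)
      \<comment> \<open>The relation expresses the transform of \<open>\<psi> l\<close> at exponent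
        \<open>k\<close> through that of \<open>\<phi>\<close> at \<open>k - 1\<close>, so vanishing
        of \<open>a\<close> along the orbit puts \<open>w\<close> in the excluded null set.\<close>
      have "fourier p \<mu> (\<psi> l) (dil k w) = 0" if "l \<in> {1..p - 1}" for k l
        using psi_norm[OF that, of "k - 1"] a0[of "k - 1"] by simp
      then show False
        using elim(5) w by blast
    qed
  qed
  then show ?thesis
    using AE_iff_null_sets[OF sets_N0[OF m0]] by blast
qed

end

theorem theorem2p9:
  fixes p \<alpha> :: nat
    and \<mu> :: "vseq measure"
    and \<psi> m s :: "nat \<Rightarrow> vseq \<Rightarrow> complex"
    and \<phi> :: "vseq \<Rightarrow> complex"
  assumes "prime p"
    and "haar_measure p \<mu>"
    and "mra_pfmw p \<mu> \<psi>"
    and "pseudo_scaling p \<mu> \<phi>"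
    and "m \<in> gen_filters_of p \<mu> \<phi>"
    and "\<forall>i\<in>{1..p-1}. unimodular p \<mu> (s i)"
    and "\<forall>i\<in>{1..p-1}. AE \<omega> in \<mu>.
           fourier p \<mu> (\<psi> i) (dil 1 \<omega>) =
             Wstar p \<alpha> \<omega> * s i (dil 1 \<omega>) * cnj (m i \<omega>) * fourier p \<mu> \<phi> \<omega>"
  shows "m \<in> gen_low_pass_filters p \<mu>"
proof -
  interpret vilenkin_pfmw p \<mu> \<psi>
    using assms(1-3) by unfold_locales (simp_all add: mra_pfmw_def)
  show ?thesis
    unfolding gen_low_pass_filters_def
    using N0_null[OF assms(5-7)] assms(5) by (simp add: gen_filters_of_def)
qed


end
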